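(* Let $(X,d,m)$ be a PI space and $E\subset X$ a bounded $BV$-extension set with $m(E)>0$. Then there exists a constant $C>0$ such that for all $x\in\overline{X\setminus E^0}$ and $0<r<\mathrm{diam}(E)$ we have $$m(B(x,r)\cap E)\ge C\,m(B(x,r)).$$
   Context: A metric measure space $(X,d,m)$: $(X,d)$ is complete and separable and $m$ is a nonnegative Borel measure finite on bounded sets. $\mathrm{lip}\,u(x)=\limsup_{y\to x}|u(y)-u(x)|/d(x,y)$ if $x$ is an accumulation point, $0$ otherwise. PI space: $m$ is doubling (there is $C_m>0$ with $0<m(B(x,2r))\le C_m\,m(B(x,r))<\infty$ for all $x\in X$, $r>0$) and a $(1,1)$-Poincaré inequality holds: there are $C>0$, $\lambda\ge1$ such that for every locally Lipschitz $u\colon X\to\mathbb{R}$, $x\in X$, $r>0$, $\frac{1}{m(B(x,r))}\int_{B(x,r)}|u-u_{B(x,r)}|\,dm\le \frac{Cr}{m(B(x,\lambda r))}\int_{B(x,\lambda r)}\mathrm{lip}\,u\,dm$, where $u_A$ is the average of $u$ over $A$. $E^0:=\{x\in X: \limsup_{r\to0} m(B(x,r)\cap E)/m(B(x,r))=0\}$. $BV$. For $u\in L^1_{loc}(X)$ and $A$ open, $|Du|(A):=\inf\{\liminf_n\int_A \mathrm{lip}\,u_n\,dm : u_n\in \mathrm{Lip}_{loc}(A),\ u_n\to u \text{ in } L^1_{loc}(m|_A)\}$ ($\mathrm{Lip}_{loc}$: locally Lipschitz); for $B$ Borel, $|Du|(B):=\inf\{|Du|(A): A\supset B \text{ open}\}$.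 For $B$ Borel and $u\in L^1_{loc}(m|_B)$, $|Du|_B$ is the total variation of $u$ computed in $(X,d,m|_B)$. $BV(B):=\{u\in L^1(m|_B): |Du|_B(B)<\infty\}$ with norm $\|u\|_{BV(B)}=\|u\|_{L^1(m|_B)}+|Du|_B(B)$. A Borel set $E$ is a $BV$-extension set if there exist $C\ge1$ and a (not necessarily linear) map $T\colon BV(E)\to BV(X)$ with $Tu=u$ ($m$-a.e.) on $E$ and $\|Tu\|_{BV(X)}\le C\|u\|_{BV(E)}$ for every $u\in BV(E)$. *)

theory Defs
  imports "HOL-Analysis.Analysis"
begin

text \<open>
  The metric space \<open>(X,d)\<close> is a type of class \<^class>\<open>polish_space\<close> (complete and second countable,
  i.e. complete and separable); \<open>B(x,r)\<close> is the open ball \<^term>\<open>ball x r\<close>.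
\<close>

definition metric_measure_space :: "'a::polish_space measure \<Rightarrow> bool" where
  "metric_measure_space m \<longleftrightarrow>
     sets m = sets borel \<and> (\<forall>A \<in> sets borel. bounded A \<longrightarrow> emeasure m A < \<infinity>)"

definition lip :: "('a::metric_space \<Rightarrow> real) \<Rightarrow> 'a \<Rightarrow> ennreal" where
  "lip u x = (if x islimpt UNIV
              then Limsup (at x) (\<lambda>y. ennreal (\<bar>u y - u x\<bar> / dist y x)) else 0)"

text \<open>
  A function on an open set \<open>A\<close> is represented by a total function whose values off \<open>A\<close> are
  irrelevant. As \<open>A\<close> is open, \<^term>\<open>lip u x\<close> for \<open>x \<in> A\<close> only depends on \<open>u\<close> on \<open>A\<close>.
\<close>

definition locally_Lipschitz_on :: "'a::metric_space set \<Rightarrow> ('a \<Rightarrow> real) \<Rightarrow> bool" where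
  "locally_Lipschitz_on A u \<longleftrightarrow> (\<forall>x\<in>A. \<exists>r>0. \<exists>L. L-lipschitz_on (ball x r \<inter> A) u)"

definition doubling :: "'a::metric_space measure \<Rightarrow> bool" where
  "doubling m \<longleftrightarrow> (\<exists>C::real. C > 0 \<and> (\<forall>x r. r > 0 \<longrightarrow>
     0 < emeasure m (ball x (2 * r)) \<and>
     emeasure m (ball x (2 * r)) \<le> ennreal C * emeasure m (ball x r) \<and>
     ennreal C * emeasure m (ball x r) < \<infinity>))"

definition average :: "'a measure \<Rightarrow> 'a set \<Rightarrow> ('a \<Rightarrow> real) \<Rightarrow> real" where
  "average m A u = (LINT x:A|m. u x) / measure m A"

definition Poincare_1_1 :: "'a::metric_space measure \<Rightarrow> bool" where
  "Poincare_1_1 m \<longleftrightarrow> (\<exists>C::real. \<exists>\<Lambda>::real. C > 0 \<and> \<Lambda> \<ge> 1 \<and>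
     (\<forall>u x r. locally_Lipschitz_on UNIV u \<and> r > 0 \<longrightarrow>
        (\<integral>\<^sup>+y\<in>ball x r. ennreal \<bar>u y - average m (ball x r) u\<bar> \<partial>m) / emeasure m (ball x r)
        \<le> ennreal (C * r) / emeasure m (ball x (\<Lambda> * r)) * (\<integral>\<^sup>+y\<in>ball x (\<Lambda> * r). lip u y \<partial>m)))"

definition PI_space :: "'a::polish_space measure \<Rightarrow> bool" where
  "PI_space m \<longleftrightarrow> metric_measure_space m \<and> doubling m \<and> Poincare_1_1 m"

definition density_zero_points :: "'a::metric_space measure \<Rightarrow> 'a set \<Rightarrow> 'a set" where
  "density_zero_points m E =
     {x. Limsup (at_right (0::real)) (\<lambda>r. emeasure m (ball x r \<inter> E) / emeasure m (ball x r)) = 0}"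

text \<open>
  Convergence in \<open>L\<^sup>1\<^sub>l\<^sub>o\<^sub>c\<close> on the open set \<open>A\<close>: every point of \<open>A\<close> has a neighbourhood on which there
  is convergence in \<open>L\<^sup>1\<close>.
\<close>

definition L1_loc_converges ::
    "'a::metric_space measure \<Rightarrow> 'a set \<Rightarrow> (nat \<Rightarrow> 'a \<Rightarrow> real) \<Rightarrow> ('a \<Rightarrow> real) \<Rightarrow> bool" where
  "L1_loc_converges \<mu> A v u \<longleftrightarrow>
     (\<forall>x\<in>A. \<exists>r>0. (\<lambda>n. \<integral>\<^sup>+y\<in>ball x r \<inter> A. ennreal \<bar>v n y - u y\<bar> \<partial>\<mu>) \<longlonglongrightarrow> 0)"

definition total_variation_open ::
    "'a::metric_space measure \<Rightarrow> ('a \<Rightarrow> real) \<Rightarrow> 'a set \<Rightarrow> ennreal" where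
  "total_variation_open \<mu> u A =
     Inf {liminf (\<lambda>n. \<integral>\<^sup>+x\<in>A. lip (v n) x \<partial>\<mu>) | v.
            (\<forall>n. locally_Lipschitz_on A (v n)) \<and> L1_loc_converges \<mu> A v u}"

definition total_variation ::
    "'a::metric_space measure \<Rightarrow> ('a \<Rightarrow> real) \<Rightarrow> 'a set \<Rightarrow> ennreal" where
  "total_variation \<mu> u B = Inf {total_variation_open \<mu> u A | A. open A \<and> B \<subseteq> A}"

text \<open>
  \<open>m\<close> restricted to \<open>B\<close>, as a measure on all of \<open>X\<close>: for measurable \<open>A\<close> and \<open>B\<close> it maps \<open>A\<close> to
  \<open>m (A \<inter> B)\<close>. The library's \<^const>\<open>restrict_space\<close> would instead change the ambient space, whereas
  the total variation relative to \<open>B\<close> is computed in \<open>X\<close>, with open sets and slopes of \<open>X\<close>.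
\<close>

definition measure_restr :: "'a measure \<Rightarrow> 'a set \<Rightarrow> 'a measure" where
  "measure_restr m B = density m (indicator B)"

text \<open>
  Elements of \<open>BV(B)\<close> are represented by Borel functions on \<open>X\<close>; all notions below only depend on
  their \<open>m\<close>-a.e. class on \<open>B\<close>.
\<close>

definition BV :: "'a::metric_space measure \<Rightarrow> 'a set \<Rightarrow> ('a \<Rightarrow> real) set" where
  "BV m B = {u. integrable (measure_restr m B) u \<and> total_variation (measure_restr m B) u B < \<infinity>}"

definition BV_norm :: "'a::metric_space measure \<Rightarrow> 'a set \<Rightarrow> ('a \<Rightarrow> real) \<Rightarrow> ennreal" where
  "BV_norm m B u =
     (\<integral>\<^sup>+x. ennreal \<bar>u x\<bar> \<partial>measure_restr m B) + total_variation (measure_restr m B) u B"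

text \<open>
  The extension map acts on representatives. It is not required to be linear, so precomposing with a
  choice of representatives turns it into a map on a.e. classes, and vice versa.
\<close>

definition BV_extension_set :: "'a::metric_space measure \<Rightarrow> 'a set \<Rightarrow> bool" where
  "BV_extension_set m E \<longleftrightarrow> E \<in> sets borel \<and>
     (\<exists>(C::real) T. C \<ge> 1 \<and> (\<forall>u \<in> BV m E.
        T u \<in> BV m UNIV \<and> (AE x in m. x \<in> E \<longrightarrow> T u x = u x) \<and>
        BV_norm m UNIV (T u) \<le> ennreal C * BV_norm m E u))"

end

theory Submission
  imports Defs
begin

text \<open>
  Fix a point \<open>x\<close> and write \<open>f(s) = m(B(x,s) \<inter> E)\<close> and \<open>g(s) = m(B(x,s))\<close>. A point
  outside \<open>E\<^sup>0\<close> has \<open>f(s) > 0\<close> for all \<open>s > 0\<close>, and this property passes to the closure. The aim is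
  \<open>f(r) \<ge> c g(r)\<close> with \<open>c\<close> independent of \<open>x\<close> and of \<open>r < diam E\<close>.

  The function on \<open>E\<close> that is \<open>1\<close> on \<open>B(x,s)\<close>, \<open>0\<close> off \<open>B(x,t)\<close> and has slope of order \<open>1/(t-s)\<close> in
  between has \<open>BV\<close> norm at most a constant times \<open>f(t)/(t-s)\<close>, where the \<open>L\<^sup>1\<close> part is absorbed because
  \<open>t - s \<le> diam E\<close>. Its extension is a \<open>BV\<close> function on \<open>X\<close> that separates \<open>E \<inter> B(x,s)\<close> from
  \<open>E \<inter> B(x,2R) - B(x,t)\<close>. In a PI space such a separation has a price of isoperimetric type
  (\<open>separation_total_variation\<close>): if both sets have measure at least \<open>a\<close>, the variation \<open>J\<close> satisfies,
  for every \<open>K\<close>, either \<open>g(2R) \<le> A R J \<beta>\<^sup>K\<close> or \<open>2\<^sup>K a \<le> A R J\<close>. Optimising in \<open>K\<close> would give the usual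
  bound of \<open>R J / g\<close> from below by a power less than one of \<open>a / g\<close>; leaving \<open>K\<close> free keeps
  the argument free of real exponents.

  There are two cases at a scale \<open>R\<close>, distinguished by a constant \<open>\<eta>\<close> that depends on the doubling
  constant only.

  \<^item> \<open>f(2R) \<ge> (1 + \<eta>) f(R)\<close>. Then \<open>E \<inter> B(x,2R) - B(x,t)\<close> has measure at least \<open>\<eta> f(s)\<close> for all
    \<open>s < t \<le> R\<close>, and the price bounds \<open>f(s)\<close> superlinearly by \<open>f(t)\<close> (\<open>extension_measure_decay\<close>). If
    \<open>f(R)/g(2R)\<close> were too small, iteration over radii decreasing to \<open>R/2\<close> would yield
    \<open>f(R/2) = 0\<close> (\<open>De_Giorgi_iteration\<close>). Hence \<open>f(R) \<ge> c g(R)\<close>.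

  \<^item> \<open>f(2R) \<le> (1 + \<eta>) f(R)\<close>. An annulus in a PI space is nonempty if there are points
    farther out (\<open>annulus_nonempty\<close>), hence \<open>g(2R) \<ge> (1 + \<eta>) g(R)\<close> for \<open>R \<le> diam E / 4\<close>
    (\<open>reverse_doubling\<close>). With the same \<open>\<eta>\<close> on both sides
    \<open>f(R)/g(R) \<ge> f(2R)/g(2R)\<close>, so that the claim at scale \<open>2R\<close> implies the claim at scale \<open>R\<close> without any
    loss, however often this case occurs.

  Once the radius exceeds \<open>diam E\<close> the ball contains \<open>E\<close>, and the density is bounded below by \<open>m(E)\<close>
  divided by the measure of a fixed large ball. Only the boundedly many doublings between
  \<open>diam E / 4\<close> and \<open>diam E\<close> lose a factor \<open>1 + \<eta>\<close> each.
\<close>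

section \<open>Slopes of locally Lipschitz functions\<close>

text \<open>
  At an isolated point \<^term>\<open>at x\<close> is the trivial filter, where the upper limit in
  \<^typ>\<open>ennreal\<close> is \<open>0\<close>; the case distinction in the definition is thus absorbed.
\<close>

lemma lip_eq_Limsup: "lip u x = Limsup (at x) (\<lambda>y. ennreal (\<bar>u y - u x\<bar> / dist y x))"
proof (cases "x islimpt UNIV")
  case False
  then have "at x = bot" using trivial_limit_at_iff by blast
  then show ?thesis using False by (simp add: lip_def bot_ennreal)
qed (simp add: lip_def)

text \<open>
  Countably many radii suffice, which reduces measurability of the slope to that of each supremum.
\<close>

lemma lip_eq_INF:
  "lip u x = (INF n. SUP y\<in>ball x (inverse (real (Suc n))) - {x}. ennreal (\<bar>u y - u x\<bar> / dist y x))"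
  (is "_ = (INF n. SUP y\<in>?B n. ?q y)")
proof (rule antisym)
  show "lip u x \<le> (INF n. SUP y\<in>?B n. ?q y)"
    unfolding lip_eq_Limsup
  proof (rule INF_greatest)
    fix n :: nat
    have "eventually (\<lambda>y. y \<in> ball x (inverse (real (Suc n))) \<and> y \<noteq> x) (at x)"
      by (simp add: eventually_at, intro exI[of _ "inverse (real (Suc n))"], auto simp: dist_commute)
    then have "Limsup (at x) ?q \<le> (SUP y\<in>{y. y \<in> ball x (inverse (real (Suc n))) \<and> y \<noteq> x}. ?q y)"
      unfolding Limsup_def by (intro INF_lower) simp
    also have "{y. y \<in> ball x (inverse (real (Suc n))) \<and> y \<noteq> x} = ?B n" by auto
    finally show "Limsup (at x) ?q \<le> (SUP y\<in>?B n. ?q y)" .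
  qed
  show "(INF n. SUP y\<in>?B n. ?q y) \<le> lip u x"
    unfolding lip_eq_Limsup Limsup_def
  proof (rule INF_greatest)
    fix P assume "P \<in> {P. eventually P (at x)}"
    then obtain d where d: "d > 0" "\<And>y. y \<noteq> x \<Longrightarrow> dist y x < d \<Longrightarrow> P y"
      by (auto simp: eventually_at)
    obtain n where n: "inverse (real (Suc n)) < d" using reals_Archimedean[OF d(1)] by auto
    have "?B n \<subseteq> Collect P" using n d(2) by (auto simp: dist_commute)
    then show "(INF n. SUP y\<in>?B n. ?q y) \<le> Sup (?q ` Collect P)"
      by (intro INF_lower2[of n] SUP_subset_mono) auto
  qed
qed

text \<open>
  For a fixed radius the supremum of the difference quotients is lower semicontinuous in \<open>x\<close>: a
  quotient \<open>> c\<close> with a witness \<open>y\<close> stays \<open>> c\<close> with the same \<open>y\<close> when \<open>x\<close> moves a little.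
\<close>

lemma borel_measurable_lip:
  fixes u :: "'a::metric_space \<Rightarrow> real"
  assumes u: "continuous_on UNIV u"
  shows "lip u \<in> borel_measurable borel"
proof -
  have "(\<lambda>x. SUP y\<in>ball x e - {x}. ennreal (\<bar>u y - u x\<bar> / dist y x)) \<in> borel_measurable borel" for e :: real
  proof (rule borel_measurableI_greater)
    fix c :: ennreal
    have "open {x. c < (SUP y\<in>ball x e - {x}. ennreal (\<bar>u y - u x\<bar> / dist y x))}"
    proof (subst open_subopen, safe)
      fix x assume "c < (SUP y\<in>ball x e - {x}. ennreal (\<bar>u y - u x\<bar> / dist y x))"
      then obtain y where "y \<in> ball x e - {x}" and yc: "c < ennreal (\<bar>u y - u x\<bar> / dist y x)"
        unfolding less_SUP_iff by blast
      then have y: "dist x y < e" "y \<noteq> x" by auto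
      let ?U = "{z. dist z y < e} \<inter> (- {y} \<inter> (\<lambda>z. ennreal (\<bar>u y - u z\<bar> / dist y z)) -` {c<..})"
      have "continuous_on (- {y}) (\<lambda>z. \<bar>u y - u z\<bar> / dist y z)"
        by (intro continuous_intros continuous_on_subset[OF u]) auto
      then have "continuous_on (- {y}) (\<lambda>z. ennreal (\<bar>u y - u z\<bar> / dist y z))"
        by (intro continuous_on_ennreal)
      then have "open (- {y} \<inter> (\<lambda>z. ennreal (\<bar>u y - u z\<bar> / dist y z)) -` {c<..})"
        by (intro continuous_open_preimage) auto
      moreover have "open {z. dist z y < e}"
        by (intro open_Collect_less continuous_intros)
      ultimately have "open ?U" by (rule open_Int[rotated])
      moreover have "x \<in> ?U" using y yc by auto
      moreover have "?U \<subseteq> {x. c < (SUP y\<in>ball x e - {x}. ennreal (\<bar>u y - u x\<bar> / dist y x))}"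
      proof
        fix z assume "z \<in> ?U"
        then have "y \<in> ball z e - {z}" "c < ennreal (\<bar>u y - u z\<bar> / dist y z)" by auto
        then show "z \<in> {x. c < (SUP y\<in>ball x e - {x}. ennreal (\<bar>u y - u x\<bar> / dist y x))}"
          unfolding mem_Collect_eq less_SUP_iff by blast
      qed
      ultimately show "\<exists>T. open T \<and> x \<in> T \<and> T \<subseteq> {x. c < (SUP y\<in>ball x e - {x}. ennreal (\<bar>u y - u x\<bar> / dist y x))}"
        by (intro exI conjI)
    qed
    then show "{x \<in> space borel. c < (SUP y\<in>ball x e - {x}. ennreal (\<bar>u y - u x\<bar> / dist y x))} \<in> sets borel"
      by simp
  qed
  then show ?thesis
    unfolding lip_eq_INF[abs_def] by (intro borel_measurable_INF) auto
qed

lemma locally_Lipschitz_on_UNIV_continuous: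
  assumes "locally_Lipschitz_on UNIV u"
  shows "continuous_on UNIV u"
proof -
  have "isCont u x" for x
  proof -
    obtain r L where "r > 0" "L-lipschitz_on (ball x r) u"
      using assms unfolding locally_Lipschitz_on_def by (metis UNIV_I inf_top.right_neutral)
    then have "continuous_on (ball x r) u" by (simp add: lipschitz_on_continuous_on)
    with \<open>r > 0\<close> show ?thesis by (simp add: continuous_on_eq_continuous_at)
  qed
  then show ?thesis by (simp add: continuous_at_imp_continuous_on)
qed

lemma Lipschitz_imp_locally:
  "L-lipschitz_on UNIV u \<Longrightarrow> locally_Lipschitz_on UNIV u"
  unfolding locally_Lipschitz_on_def
  by (metis UNIV_I inf_top.right_neutral lipschitz_on_subset subset_UNIV zero_less_one)

lemma lip_le_Lipschitz:
  assumes "L-lipschitz_on UNIV u"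
  shows "lip u x \<le> ennreal L"
  unfolding lip_eq_Limsup
proof (rule Limsup_bounded)
  show "eventually (\<lambda>y. ennreal (\<bar>u y - u x\<bar> / dist y x) \<le> ennreal L) (at x)"
    unfolding eventually_at_filter
  proof (intro always_eventually allI impI)
    fix y assume "y \<noteq> x"
    moreover have "\<bar>u y - u x\<bar> \<le> L * dist y x"
      using lipschitz_onD[OF assms, of y x] by (simp add: dist_real_def)
    ultimately show "ennreal (\<bar>u y - u x\<bar> / dist y x) \<le> ennreal L"
      by (intro ennreal_leI) (simp add: divide_le_eq)
  qed
qed

lemma lip_locally_constant:
  assumes "open U" "x \<in> U" "\<And>y. y \<in> U \<Longrightarrow> u y = c"
  shows "lip u x = 0"
proof -
  have "eventually (\<lambda>y. y \<in> U) (at x)"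
    using assms by (intro eventually_at_in_open') auto
  then have "eventually (\<lambda>y. ennreal (\<bar>u y - u x\<bar> / dist y x) \<le> 0) (at x)"
    by (rule eventually_mono) (use assms in simp)
  then have "lip u x \<le> 0" unfolding lip_eq_Limsup by (rule Limsup_bounded)
  then show ?thesis by simp
qed

text \<open>
  The function falls from \<open>1\<close> to \<open>0\<close> already on the first half of \<open>[s, t]\<close>. This costs a factor \<open>2\<close> in
  the slope, but makes the slope vanish at distance exactly \<open>t\<close>, so that the open ball \<^term>\<open>ball x t\<close>
  carries it.
\<close>

lemma Lipschitz_cutoff:
  fixes x :: "'a::metric_space"
  assumes st: "0 < s" "s < t"
  obtains u :: "'a \<Rightarrow> real" where "(2 / (t - s))-lipschitz_on UNIV u"
    "\<And>y. y \<in> ball x s \<Longrightarrow> u y = 1" "\<And>y. y \<notin> ball x t \<Longrightarrow> u y = 0"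
    "\<And>y. \<bar>u y\<bar> \<le> indicator (ball x t) y"
    "\<And>y. lip u y \<le> ennreal (2 / (t - s)) * indicator (ball x t) y"
proof
  define q where "q = (s + t) / 2"
  define u where "u y = max 0 (min 1 ((q - dist x y) / (q - s)))" for y
  have q: "s < q" "q < t" "q - s = (t - s) / 2" using st by (auto simp: q_def field_simps)
  show L: "(2 / (t - s))-lipschitz_on UNIV u"
  proof (rule lipschitz_onI)
    fix y z
    have "\<bar>u y - u z\<bar> \<le> \<bar>(q - dist x y) / (q - s) - (q - dist x z) / (q - s)\<bar>"
      unfolding u_def by linarith
    also have "\<dots> = \<bar>dist x z - dist x y\<bar> / (q - s)"
      using q by (simp add: diff_divide_distrib[symmetric] abs_divide)
    also have "\<dots> \<le> dist y z / (q - s)"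
      using q dist_triangle[of x y z] dist_triangle[of x z y]
      by (intro divide_right_mono) (auto simp: dist_commute)
    also have "\<dots> = 2 / (t - s) * dist y z" unfolding q(3) by simp
    finally show "dist (u y) (u z) \<le> 2 / (t - s) * dist y z" by (simp add: dist_real_def)
  qed (use st in auto)
  have outside: "u y = 0" if "dist x y \<ge> q" for y
    using that q by (simp add: u_def divide_nonpos_pos)
  show "u y = 1" if "y \<in> ball x s" for y
    using that q by (simp add: u_def)
  show u0: "u y = 0" if "y \<notin> ball x t" for y
    using that q by (intro outside) auto
  show "\<bar>u y\<bar> \<le> indicator (ball x t) y" for y
  proof (cases "y \<in> ball x t")
    case True
    then show ?thesis by (simp add: u_def)
  next
    case False
    then show ?thesis using u0[OF False] by simp
  qed
  show "lip u y \<le> ennreal (2 / (t - s)) * indicator (ball x t) y" for y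
  proof (cases "y \<in> ball x t")
    case True
    then show ?thesis using lip_le_Lipschitz[OF L, of y] by simp
  next
    case False
    have "open (- cball x q)" by auto
    then have "lip u y = 0" using False q by (intro lip_locally_constant[where c = 0]) (auto intro!: outside)
    then show ?thesis by simp
  qed
qed

section \<open>Local convergence in the mean and convergence in measure\<close>

text \<open>
  By the Lindelof property countably many of the balls on which there is convergence cover the
  space, finitely many cover \<open>F\<close> up to measure \<open>d/2\<close>, and on their union Markov's inequality applies.
\<close>

lemma L1_loc_converges_in_measure:
  fixes m :: "'a::polish_space measure"
  assumes sets_m: "sets m = sets borel" and F: "F \<in> sets borel" "emeasure m F < \<infinity>"
    and v: "\<And>n. v n \<in> borel_measurable m" and w: "w \<in> borel_measurable m"
    and conv: "L1_loc_converges m UNIV v w" and e: "e > 0" and d: "d > 0"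
  shows "eventually (\<lambda>n. measure m {y \<in> F. e \<le> \<bar>v n y - w y\<bar>} < d) sequentially"
proof -
  have "\<forall>x. \<exists>r>0. (\<lambda>n. \<integral>\<^sup>+y\<in>ball x r. ennreal \<bar>v n y - w y\<bar> \<partial>m) \<longlonglongrightarrow> 0"
    using conv by (simp add: L1_loc_converges_def)
  from choice[OF this] obtain r where r: "\<And>x. r x > 0"
      "\<And>x. (\<lambda>n. \<integral>\<^sup>+y\<in>ball x (r x). ennreal \<bar>v n y - w y\<bar> \<partial>m) \<longlonglongrightarrow> 0"
    by blast
  obtain \<F> where \<F>: "\<F> \<subseteq> range (\<lambda>x. ball x (r x))" "countable \<F>" "\<Union>\<F> = (\<Union>x. ball x (r x))"
    using Lindelof[of "range (\<lambda>x. ball x (r x))"] by (auto simp: image_iff)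
  have cover: "\<Union>\<F> = UNIV" unfolding \<F>(3) using r(1) by auto
  then have "\<F> \<noteq> {}" by auto
  then obtain U where U: "\<F> = range (U :: nat \<Rightarrow> 'a set)"
    using \<F>(2) uncountable_def by metis
  have Ui: "\<exists>x. U i = ball x (r x)" for i using \<F>(1) U by auto
  then have Ub: "U i \<in> sets m" for i unfolding sets_m by (metis open_ball borel_open)
  have Uc: "(\<lambda>n. \<integral>\<^sup>+y\<in>U i. ennreal \<bar>v n y - w y\<bar> \<partial>m) \<longlonglongrightarrow> 0" for i
    using Ui[of i] r(2) by auto
  have Fm: "F \<in> sets m" using F by (simp add: sets_m)
  have Ff: "F \<in> fmeasurable m" using Fm F by (auto simp: fmeasurable_def)
  define G where "G N = F \<inter> (\<Union>i<N. U i)" for N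
  have Gm: "G N \<in> sets m" for N unfolding G_def using Fm Ub by auto
  have "(\<Union>N. G N) = F" unfolding G_def using cover U by auto
  moreover have "incseq G" unfolding G_def by (force intro!: incseq_SucI)
  moreover have "emeasure m (\<Union>N. G N) \<noteq> \<infinity>" using F \<open>(\<Union>N. G N) = F\<close> by simp
  ultimately have "(\<lambda>N. measure m (G N)) \<longlonglongrightarrow> measure m F"
    using Lim_measure_incseq[of G m] Gm by auto
  then have "eventually (\<lambda>N. measure m F - d / 2 < measure m (G N)) sequentially"
    using d by (intro order_tendstoD) auto
  then obtain N where N: "measure m F - d / 2 < measure m (G N)"
    by (auto simp: eventually_sequentially)
  have "(\<lambda>n. \<Sum>i<N. \<integral>\<^sup>+y\<in>U i. ennreal \<bar>v n y - w y\<bar> \<partial>m) \<longlonglongrightarrow> (\<Sum>i<N. 0)"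
    by (intro tendsto_sum Uc)
  then have "eventually (\<lambda>n. (\<Sum>i<N. \<integral>\<^sup>+y\<in>U i. ennreal \<bar>v n y - w y\<bar> \<partial>m) < ennreal (e * d / 2)) sequentially"
    using e d by (intro order_tendstoD) auto
  then show ?thesis
  proof (rule eventually_mono)
    fix n assume sm: "(\<Sum>i<N. \<integral>\<^sup>+y\<in>U i. ennreal \<bar>v n y - w y\<bar> \<partial>m) < ennreal (e * d / 2)"
    define S where "S = {y \<in> G N. e \<le> \<bar>v n y - w y\<bar>}"
    have Sm: "S \<in> sets m"
    proof -
      have "S = G N \<inter> {y \<in> space m. e \<le> \<bar>v n y - w y\<bar>}"
        using sets.sets_into_space[OF Gm] by (auto simp: S_def)
      also have "\<dots> \<in> sets m" using Gm v[of n] w by measurable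
      finally show ?thesis .
    qed
    have sf: "S \<in> fmeasurable m"
      using Sm Ff by (rule fmeasurableI2[rotated 2]) (auto simp: S_def G_def)
    have "ennreal e * emeasure m S = (\<integral>\<^sup>+y. ennreal e * indicator S y \<partial>m)"
      using Sm by (simp add: nn_integral_cmult)
    also have "\<dots> \<le> (\<integral>\<^sup>+y. (\<Sum>i<N. ennreal \<bar>v n y - w y\<bar> * indicator (U i) y) \<partial>m)"
    proof (rule nn_integral_mono)
      fix y
      show "ennreal e * indicator S y \<le> (\<Sum>i<N. ennreal \<bar>v n y - w y\<bar> * indicator (U i) y)"
      proof (cases "y \<in> S")
        case True
        then obtain i where i: "i < N" "y \<in> U i" "e \<le> \<bar>v n y - w y\<bar>" by (auto simp: S_def G_def)
        then have "ennreal e * indicator S y \<le> ennreal \<bar>v n y - w y\<bar> * indicator (U i) y"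
          using True by (simp add: ennreal_leI)
        also have "\<dots> \<le> (\<Sum>i<N. ennreal \<bar>v n y - w y\<bar> * indicator (U i) y)"
          using i(1) by (intro member_le_sum) auto
        finally show ?thesis .
      qed simp
    qed
    also have "\<dots> = (\<Sum>i<N. \<integral>\<^sup>+y\<in>U i. ennreal \<bar>v n y - w y\<bar> \<partial>m)"
      using v[of n] w by (intro nn_integral_sum borel_measurable_times_ennreal borel_measurable_indicator Ub) measurable
    also note sm
    finally have "ennreal (e * measure m S) < ennreal (e * (d / 2))"
      using e emeasure_eq_measure2[OF sf] by (simp add: ennreal_mult')
    then have "measure m S < d / 2" using e by (simp add: ennreal_less_iff)
    moreover have "measure m (F - G N) = measure m F - measure m (G N)"
      using Ff Gm by (intro measure_Diff) (auto simp: fmeasurable_def G_def)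
    moreover have "measure m {y \<in> F. e \<le> \<bar>v n y - w y\<bar>} \<le> measure m (S \<union> (F - G N))"
    proof (rule measure_mono_fmeasurable)
      have "{y \<in> F. e \<le> \<bar>v n y - w y\<bar>} = F \<inter> {y \<in> space m. e \<le> \<bar>v n y - w y\<bar>}"
        using sets.sets_into_space[OF Fm] by auto
      also have "\<dots> \<in> sets m" using Fm v[of n] w by measurable
      finally show "{y \<in> F. e \<le> \<bar>v n y - w y\<bar>} \<in> sets m" .
      show "S \<union> (F - G N) \<in> fmeasurable m" by (intro fmeasurable.Un fmeasurable_Diff sf Ff Gm)
    qed (auto simp: S_def)
    moreover have "measure m (S \<union> (F - G N)) \<le> measure m S + measure m (F - G N)"
      using Sm Fm Gm by (intro measure_Un_le) auto
    ultimately show "measure m {y \<in> F. e \<le> \<bar>v n y - w y\<bar>} < d" using N by linarith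
  qed
qed

section \<open>A De Giorgi iteration\<close>

text \<open>
  Along the radii \<open>t\<^sub>i = R (1/2 + 2\<^sup>-\<^sup>i\<^sup>-\<^sup>1)\<close>, whose gaps are \<open>R 2\<^sup>-\<^sup>i\<^sup>-\<^sup>2\<close>, the values of \<open>f\<close> decay like
  \<open>(2\<beta>)\<^sup>-\<^sup>i\<close> if \<open>f R\<close> is too small, and then \<open>f (R/2) = 0\<close>. The step from \<open>t\<^sub>i\<close> to \<open>t\<^sub>i\<^sub>+\<^sub>1\<close> uses the hypothesis
  with \<open>K = K0 + i\<close>: the rate \<open>1/(2\<beta>)\<close> is just fast enough to make the first alternative fail for
  all \<open>i\<close>, while the second one then reproduces this rate, by the choice of \<open>K0\<close>.
\<close>

lemma De_Giorgi_iteration: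
  fixes f :: "real \<Rightarrow> real"
  assumes R: "R > 0" and f_pos: "\<And>s. s > 0 \<Longrightarrow> f s > 0" and f_mono: "\<And>s t. s \<le> t \<Longrightarrow> f s \<le> f t"
    and B: "B > 0" and \<beta>: "\<beta> \<ge> 1" and K0: "8 * B * \<beta> \<le> 2 ^ K0"
    and step: "\<And>s t K. 0 < s \<Longrightarrow> s < t \<Longrightarrow> t \<le> R \<Longrightarrow>
      V * (t - s) \<le> B * R * f t * \<beta> ^ K \<or> 2 ^ K * f s * (t - s) \<le> B * R * f t"
  shows "V \<le> 4 * B * \<beta> ^ K0 * f R"
proof (rule ccontr)
  assume "\<not> ?thesis"
  then have V: "4 * B * \<beta> ^ K0 * f R < V" by simp
  define t where "t i = R * (1/2 + (1/2) ^ Suc i)" for i :: nat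
  have gap: "t i - t (Suc i) = R * (1/2) ^ (i + 2)" for i by (simp add: t_def field_simps)
  have t: "R / 2 < t i" "t i \<le> R" for i
    using R by (auto simp: t_def field_simps)
  have decay: "f (t i) \<le> (1 / (2 * \<beta>)) ^ i * f R" for i
  proof (induction i)
    case 0
    then show ?case by (simp add: t_def)
  next
    case (Suc i)
    have "0 < R * (1/2) ^ (i + 2)" using R by simp
    then have "0 < t (Suc i)" "t (Suc i) < t i" using R t(1)[of "Suc i"] gap[of i] by linarith+
    from step[OF this t(2), of "K0 + i"] show ?case
    proof
      assume "V * (t i - t (Suc i)) \<le> B * R * f (t i) * \<beta> ^ (K0 + i)"
      also have "\<dots> \<le> B * R * ((1 / (2 * \<beta>)) ^ i * f R) * \<beta> ^ (K0 + i)"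
        using B R \<beta> Suc by (intro mult_right_mono mult_left_mono) auto
      also have "\<dots> = R * (1/2) ^ i * (B * \<beta> ^ K0 * f R)"
        using \<beta> by (simp add: power_add power_divide power_mult_distrib)
      finally have "R * (1/2) ^ i * V \<le> R * (1/2) ^ i * (4 * B * \<beta> ^ K0 * f R)"
        unfolding gap by (simp add: power_add field_simps)
      then have "V \<le> 4 * B * \<beta> ^ K0 * f R" using R by (subst (asm) mult_le_cancel_left_pos) auto
      with V show ?thesis by simp
    next
      assume "2 ^ (K0 + i) * f (t (Suc i)) * (t i - t (Suc i)) \<le> B * R * f (t i)"
      then have "R * (2 ^ K0 * f (t (Suc i))) \<le> R * (4 * B * f (t i))"
        unfolding gap by (simp add: power_add power_divide field_simps)
      then have "2 ^ K0 * f (t (Suc i)) \<le> 4 * B * f (t i)"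
        using R by (subst (asm) mult_le_cancel_left_pos) auto
      moreover have "8 * B * \<beta> * f (t (Suc i)) \<le> 2 ^ K0 * f (t (Suc i))"
        using K0 f_pos[of "t (Suc i)"] \<open>0 < t (Suc i)\<close> by (intro mult_right_mono) auto
      ultimately have "4 * B * (2 * \<beta> * f (t (Suc i))) \<le> 4 * B * f (t i)" by (simp add: mult_ac)
      then have "2 * \<beta> * f (t (Suc i)) \<le> f (t i)" using B by (subst (asm) mult_le_cancel_left_pos) auto
      also note Suc
      finally show ?thesis using \<beta> by (simp add: field_simps)
    qed
  qed
  have "(\<lambda>i. (1 / (2 * \<beta>)) ^ i * f R) \<longlonglongrightarrow> 0 * f R"
    using \<beta> by (intro tendsto_mult LIMSEQ_realpow_zero tendsto_const) (auto simp: field_simps)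
  moreover have "f (R / 2) \<le> (1 / (2 * \<beta>)) ^ i * f R" for i
    using f_mono[of "R / 2" "t i"] t(1)[of i] decay[of i] by linarith
  ultimately have "f (R / 2) \<le> 0"
    by (intro LIMSEQ_le_const) auto
  with f_pos[of "R / 2"] R show False by simp
qed

section \<open>Doubling spaces with a Poincare inequality\<close>

text \<open>
  A doubling constant may always be enlarged; \<open>Cd \<ge> 4\<close> ensures that the geometric growth rate \<open>Cd/2\<close> below
  is at least \<open>2\<close>.
\<close>

locale doubling_Poincare_space =
  fixes m :: "'a::polish_space measure" and Cd CP \<Lambda> :: real
  assumes sets_m: "sets m = sets borel"
    and finite_on_bounded: "\<And>A. A \<in> sets borel \<Longrightarrow> bounded A \<Longrightarrow> emeasure m A < \<infinity>"
    and Cd: "Cd \<ge> 4"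
    and ball_pos: "\<And>x r. r > 0 \<Longrightarrow> measure m (ball x r) > 0"
    and ball_double: "\<And>x r. r > 0 \<Longrightarrow> measure m (ball x (2 * r)) \<le> Cd * measure m (ball x r)"
    and CP: "CP > 0" and \<Lambda>: "\<Lambda> \<ge> 1"
    and Poincare: "\<And>u x r. locally_Lipschitz_on UNIV u \<Longrightarrow> r > 0 \<Longrightarrow>
        (\<integral>\<^sup>+y\<in>ball x r. ennreal \<bar>u y - average m (ball x r) u\<bar> \<partial>m) / emeasure m (ball x r)
        \<le> ennreal (CP * r) / emeasure m (ball x (\<Lambda> * r)) * (\<integral>\<^sup>+y\<in>ball x (\<Lambda> * r). lip u y \<partial>m)"

lemma PI_space_doubling_Poincare_space:
  assumes "PI_space m"
  obtains Cd CP \<Lambda> where "doubling_Poincare_space m Cd CP \<Lambda>"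
proof -
  have mm: "sets m = sets borel" "\<And>A. A \<in> sets borel \<Longrightarrow> bounded A \<Longrightarrow> emeasure m A < \<infinity>"
    using assms by (auto simp: PI_space_def metric_measure_space_def)
  obtain C where C: "C > 0" "\<And>x r. r > 0 \<Longrightarrow> 0 < emeasure m (ball x (2 * r))"
      "\<And>x r. r > 0 \<Longrightarrow> emeasure m (ball x (2 * r)) \<le> ennreal C * emeasure m (ball x r)"
    using assms by (auto simp: PI_space_def doubling_def)
  obtain CP \<Lambda> where P: "CP > 0" "\<Lambda> \<ge> 1" "\<And>u x r. locally_Lipschitz_on UNIV u \<Longrightarrow> r > 0 \<Longrightarrow>
        (\<integral>\<^sup>+y\<in>ball x r. ennreal \<bar>u y - average m (ball x r) u\<bar> \<partial>m) / emeasure m (ball x r)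
        \<le> ennreal (CP * r) / emeasure m (ball x (\<Lambda> * r)) * (\<integral>\<^sup>+y\<in>ball x (\<Lambda> * r). lip u y \<partial>m)"
    using assms by (auto simp: PI_space_def Poincare_1_1_def)
  have em: "emeasure m (ball x r) = ennreal (measure m (ball x r))" for x r
    using mm(2)[of "ball x r"] by (intro emeasure_eq_ennreal_measure) auto
  have "measure m (ball x r) > 0" if "r > 0" for x r
    using C(2)[of "r/2" x] that by (simp add: em)
  moreover have "measure m (ball x (2 * r)) \<le> max C 4 * measure m (ball x r)" if "r > 0" for x r
  proof -
    have "measure m (ball x (2 * r)) \<le> C * measure m (ball x r)"
      using C(3)[OF that, of x] C(1) by (simp add: em ennreal_mult'[symmetric] ennreal_le_iff)
    also have "\<dots> \<le> max C 4 * measure m (ball x r)" by (intro mult_right_mono) auto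
    finally show ?thesis .
  qed
  ultimately have "doubling_Poincare_space m (max C 4) CP \<Lambda>"
    using mm P by unfold_locales auto
  then show ?thesis by (rule that)
qed

lemma measure_restr_UNIV: "measure_restr m UNIV = m"
  by (simp add: measure_restr_def density_1)

context doubling_Poincare_space
begin

lemma space_m: "space m = UNIV"
  using sets_eq_imp_space_eq[OF sets_m] by simp

lemma borel_measurable_m: "borel_measurable m = borel_measurable borel"
  by (rule measurable_cong_sets[OF sets_m refl])

lemma emeasure_bounded:
  "A \<in> sets borel \<Longrightarrow> bounded A \<Longrightarrow> emeasure m A = ennreal (measure m A)"
  using finite_on_bounded[of A] by (intro emeasure_eq_ennreal_measure) auto

lemma emeasure_ball: "emeasure m (ball x r) = ennreal (measure m (ball x r))"
  by (rule emeasure_bounded) auto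

lemma fmeasurable_bounded: "A \<in> sets borel \<Longrightarrow> bounded A \<Longrightarrow> A \<in> fmeasurable m"
  using finite_on_bounded by (intro fmeasurableI) (auto simp: sets_m)

lemma measure_mono_bounded:
  "A \<in> sets borel \<Longrightarrow> B \<in> sets borel \<Longrightarrow> bounded B \<Longrightarrow> A \<subseteq> B \<Longrightarrow> measure m A \<le> measure m B"
  by (rule measure_mono_fmeasurable) (auto simp: sets_m fmeasurable_bounded)

lemma ball_mono: "ball x r \<subseteq> ball y s \<Longrightarrow> measure m (ball x r) \<le> measure m (ball y s)"
  by (rule measure_mono_bounded) auto

lemma sigma_finite_m: "sigma_finite_measure m"
proof
  fix x0 :: 'a
  have "x \<in> \<Union>(range (\<lambda>n. ball x0 (real n)))" for x
    using reals_Archimedean2[of "dist x0 x"] by auto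
  then show "\<exists>A. countable A \<and> A \<subseteq> sets m \<and> \<Union> A = space m \<and> (\<forall>a\<in>A. emeasure m a \<noteq> \<infinity>)"
    by (intro exI[of _ "range (\<lambda>n. ball x0 (real n))"])
       (auto simp: sets_m space_m emeasure_ball)
qed

lemma ball_double_power:
  assumes "r > 0" shows "measure m (ball x r) \<le> Cd ^ k * measure m (ball x (r / 2 ^ k))"
proof (induction k)
  case (Suc k)
  have "measure m (ball x (2 * (r / 2 ^ Suc k))) \<le> Cd * measure m (ball x (r / 2 ^ Suc k))"
    using assms by (intro ball_double) auto
  then have "Cd ^ k * measure m (ball x (r / 2 ^ k)) \<le> Cd ^ k * (Cd * measure m (ball x (r / 2 ^ Suc k)))"
    using Cd by (intro mult_left_mono) auto
  with Suc show ?case by (simp add: mult_ac)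
qed simp

lemma ball_nearby:
  assumes "r > 0" "dist x y \<le> r"
  shows "measure m (ball x r) \<le> Cd * measure m (ball y r)"
proof -
  have "ball x r \<subseteq> ball y (2 * r)"
  proof
    fix z assume "z \<in> ball x r"
    then show "z \<in> ball y (2 * r)" using assms dist_triangle[of y z x] by (simp add: dist_commute)
  qed
  then have "measure m (ball x r) \<le> measure m (ball y (2 * r))" by (rule ball_mono)
  also have "\<dots> \<le> Cd * measure m (ball y r)" using assms by (intro ball_double) auto
  finally show ?thesis .
qed

text \<open>
  If \<open>u\<close> were not integrable on the ball, its average would be the default \<open>0\<close> and the left-hand side
  of the Poincare inequality infinite. Hence finite total slope forces integrability.
\<close>

lemma Poincare_on_balls:
  assumes u: "locally_Lipschitz_on UNIV u" and I: "I \<ge> 0" "(\<integral>\<^sup>+y. lip u y \<partial>m) \<le> ennreal I" and t: "t > 0"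
  shows "(\<integral>\<^sup>+y\<in>ball z t. ennreal \<bar>u y - average m (ball z t) u\<bar> \<partial>m) \<le> ennreal (CP * t * I)"
    and "set_integrable m (ball z t) u"
proof -
  let ?a = "average m (ball z t) u"
  let ?V = "measure m (ball z t)" and ?W = "measure m (ball z (\<Lambda> * t))"
  have V: "0 < ?V" "0 < ?W" using t \<Lambda> by (auto intro!: ball_pos)
  have "?V \<le> ?W"
    using t \<Lambda> by (intro ball_mono subset_ball) (simp add: mult_le_cancel_right1)
  have "(\<integral>\<^sup>+y\<in>ball z (\<Lambda> * t). lip u y \<partial>m) \<le> (\<integral>\<^sup>+y. lip u y \<partial>m)"
    by (intro nn_integral_mono) (auto simp: indicator_def)
  also note I(2)
  finally have J: "(\<integral>\<^sup>+y\<in>ball z (\<Lambda> * t). lip u y \<partial>m) \<le> ennreal I" .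
  let ?N = "\<integral>\<^sup>+y\<in>ball z t. ennreal \<bar>u y - ?a\<bar> \<partial>m"
  have "?N / ennreal ?V \<le> ennreal (CP * t) / ennreal ?W * ennreal I"
    using Poincare[OF u t, of z] J unfolding emeasure_ball
    by (meson mult_left_mono order_trans zero_le)
  also have "\<dots> = ennreal (CP * t * I / ?W)"
    using V I CP t by (simp add: divide_ennreal ennreal_mult'[symmetric])
  finally have "?N / ennreal ?V * ennreal ?V \<le> ennreal (CP * t * I / ?W) * ennreal ?V"
    by (intro mult_right_mono) auto
  moreover have "?N / ennreal ?V * ennreal ?V = ?N"
    using V by (simp add: ennreal_divide_times ennreal_divide_self)
  ultimately have "?N \<le> ennreal (CP * t * I / ?W * ?V)"
    using V I CP t by (simp add: ennreal_mult'[symmetric])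
  also have "CP * t * I / ?W * ?V \<le> CP * t * I"
  proof -
    have "CP * t * I * ?V \<le> CP * t * I * ?W"
      using \<open>?V \<le> ?W\<close> CP t I by (intro mult_left_mono) auto
    then show ?thesis using V by (simp add: field_simps)
  qed
  finally show N: "?N \<le> ennreal (CP * t * I)" by (simp add: ennreal_leI)
  have cont: "u \<in> borel_measurable m"
    using locally_Lipschitz_on_UNIV_continuous[OF u]
    unfolding borel_measurable_m by (rule borel_measurable_continuous_onI)
  have bm: "ball z t \<in> sets m" by (simp add: sets_m)
  have "set_integrable m (ball z t) (\<lambda>y. u y - ?a)"
    unfolding set_integrable_def
  proof (rule integrableI_bounded)
    show "(\<lambda>y. indicat_real (ball z t) y *\<^sub>R (u y - ?a)) \<in> borel_measurable m"
      using cont bm by measurable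
    have "(\<integral>\<^sup>+y. ennreal (norm (indicat_real (ball z t) y *\<^sub>R (u y - ?a))) \<partial>m) = ?N"
      by (intro nn_integral_cong) (auto simp: indicator_def)
    also have "\<dots> < \<infinity>" using N by (simp add: le_less_trans ennreal_less_top)
    finally show "(\<integral>\<^sup>+y. ennreal (norm (indicat_real (ball z t) y *\<^sub>R (u y - ?a))) \<partial>m) < \<infinity>" .
  qed
  moreover have "set_integrable m (ball z t) (\<lambda>y. ?a)"
    using fmeasurable_bounded[of "ball z t"]
    by (auto simp: set_integrable_def fmeasurable_def intro!: integrable_mult_left integrable_real_indicator)
  ultimately have "set_integrable m (ball z t) (\<lambda>y. (u y - ?a) + ?a)" by (rule set_integral_add)
  then show "set_integrable m (ball z t) u" by simp
qed

text \<open>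
  This is the Poincare inequality on the larger ball, restricted to the smaller one. The
  measure of the larger ball cancels against that of its dilation by \<open>\<Lambda>\<close>, up to a ratio of at most \<open>1\<close>.
\<close>

lemma average_diff_le:
  assumes u: "locally_Lipschitz_on UNIV u" and I: "I \<ge> 0" "(\<integral>\<^sup>+y. lip u y \<partial>m) \<le> ennreal I"
    and st: "s > 0" "t > 0" "ball y s \<subseteq> ball z t"
  shows "\<bar>average m (ball y s) u - average m (ball z t) u\<bar> \<le> CP * t * I / measure m (ball y s)"
proof -
  let ?c = "average m (ball z t) u" and ?V = "measure m (ball y s)"
  have V: "?V > 0" using st by (intro ball_pos)
  have int: "set_integrable m (ball y s) u" by (rule Poincare_on_balls[OF u I st(1)])
  have intc: "set_integrable m (ball y s) (\<lambda>_. ?c)"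
    using fmeasurable_bounded[of "ball y s"]
    by (auto simp: set_integrable_def fmeasurable_def intro!: integrable_mult_left integrable_real_indicator)
  have "(LINT w:ball y s|m. u w - ?c) = (LINT w:ball y s|m. u w) - ?c * ?V"
    by (subst set_integral_diff(2)[OF int intc]) (simp add: set_lebesgue_integral_def sets_m)
  then have "\<bar>average m (ball y s) u - ?c\<bar> * ?V = \<bar>LINT w:ball y s|m. u w - ?c\<bar>"
    using V by (simp add: average_def field_simps abs_mult[symmetric] flip: abs_mult_pos)
  moreover have "\<bar>LINT w:ball y s|m. u w - ?c\<bar> \<le> CP * t * I"
  proof -
    have "ennreal \<bar>LINT w:ball y s|m. u w - ?c\<bar>
        \<le> (\<integral>\<^sup>+w. ennreal (norm (indicator (ball y s) w *\<^sub>R (u w - ?c))) \<partial>m)"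
      unfolding set_lebesgue_integral_def real_norm_def[symmetric]
      by (rule integral_norm_bound_ennreal)
         (use set_integral_diff(1)[OF int intc] in \<open>simp add: set_integrable_def\<close>)
    also have "\<dots> \<le> (\<integral>\<^sup>+w\<in>ball z t. ennreal \<bar>u w - ?c\<bar> \<partial>m)"
      using st(3) by (intro nn_integral_mono) (auto simp: indicator_def)
    also have "\<dots> \<le> ennreal (CP * t * I)" by (rule Poincare_on_balls[OF u I st(2)])
    finally show ?thesis using CP st I by simp
  qed
  ultimately show ?thesis using V by (simp add: field_simps)
qed

text \<open>
  Telescoping over \<open>B(x, 4R)\<close> and the balls around \<open>y\<close> of radii \<open>R, R/2, \<dots>, R/2\<^sup>k\<close>.
  Each halving gains a factor \<open>1/2\<close> from the radius and loses at most \<open>Cd\<close> from the measure, whence the rate \<open>Cd/2\<close>; since it is at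
  least \<open>2\<close>, the last term dominates the sum.
\<close>

lemma average_chain:
  assumes u: "locally_Lipschitz_on UNIV u" and I: "I \<ge> 0" "(\<integral>\<^sup>+y. lip u y \<partial>m) \<le> ennreal I"
    and R: "R > 0" and y: "dist x y < 2 * R"
  shows "\<bar>average m (ball y (R / 2 ^ k)) u - average m (ball x (4 * R)) u\<bar>
    \<le> 4 * CP * Cd ^ 3 * (R * I / measure m (ball x R)) * (Cd / 2) ^ k"
proof -
  let ?V = "measure m (ball x R)"
  have V: "?V > 0" using R by (rule ball_pos)
  \<comment> \<open>two of the doublings pass from \<open>B(x, R)\<close> to \<open>B(y, R)\<close>\<close>
  have small: "?V / Cd ^ (k + 2) \<le> measure m (ball y (R / 2 ^ k))" for k
  proof -
    have "ball x R \<subseteq> ball y (4 * R)"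
    proof
      fix z assume "z \<in> ball x R"
      then show "z \<in> ball y (4 * R)"
        using y R dist_triangle[of y z x] by (simp add: dist_commute)
    qed
    then have "?V \<le> measure m (ball y (4 * R))" by (rule ball_mono)
    also have "\<dots> \<le> Cd ^ (k + 2) * measure m (ball y (4 * R / 2 ^ (k + 2)))"
      using R by (intro ball_double_power) auto
    finally show ?thesis using Cd by (simp add: field_simps)
  qed
  have quot: "CP * t * I / measure m (ball y (R / 2 ^ k)) \<le> CP * t * I * Cd ^ (k + 2) / ?V" if "t > 0" for t k
  proof -
    have "CP * t * I / measure m (ball y (R / 2 ^ k)) \<le> CP * t * I / (?V / Cd ^ (k + 2))"
      using small[of k] V Cd CP I that
      by (intro divide_left_mono mult_pos_pos divide_pos_pos ball_pos) (auto simp: R)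
    then show ?thesis by (simp add: field_simps)
  qed
  show ?thesis
  proof (induction k)
    case 0
    have "ball y R \<subseteq> ball x (4 * R)"
    proof
      fix z assume "z \<in> ball y R"
      then show "z \<in> ball x (4 * R)"
        using y R dist_triangle[of x z y] by (simp add: dist_commute)
    qed
    then have "\<bar>average m (ball y R) u - average m (ball x (4 * R)) u\<bar> \<le> CP * (4 * R) * I / measure m (ball y R)"
      using R by (intro average_diff_le[OF u I]) auto
    also have "\<dots> \<le> CP * (4 * R) * I * Cd ^ 2 / ?V"
      using quot[of "4 * R" 0] R by (simp add: power2_eq_square)
    also have "\<dots> \<le> CP * (4 * R) * I * Cd ^ 3 / ?V"
      using CP R I V Cd by (intro divide_right_mono mult_left_mono power_increasing) auto
    finally show ?case by (simp add: field_simps)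
  next
    case (Suc k)
    define X where "X = CP * Cd ^ 3 * (R * I / ?V) * (Cd / 2) ^ k"
    have X: "X \<ge> 0" unfolding X_def using CP Cd R I V by (intro mult_nonneg_nonneg) auto
    have "\<bar>average m (ball y (R / 2 ^ Suc k)) u - average m (ball y (R / 2 ^ k)) u\<bar>
        \<le> CP * (R / 2 ^ k) * I / measure m (ball y (R / 2 ^ Suc k))"
      using R by (intro average_diff_le[OF u I] subset_ball) (auto simp: field_simps)
    also have "\<dots> \<le> CP * (R / 2 ^ k) * I * Cd ^ (Suc k + 2) / ?V"
      using R by (intro quot) auto
    also have "\<dots> = X"
      by (simp add: X_def power_divide field_simps eval_nat_numeral)
    finally have step: "\<bar>average m (ball y (R / 2 ^ Suc k)) u - average m (ball y (R / 2 ^ k)) u\<bar> \<le> X" .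
    have "\<bar>average m (ball y (R / 2 ^ k)) u - average m (ball x (4 * R)) u\<bar> \<le> 4 * X"
      using Suc unfolding X_def by (simp only: mult.assoc)
    with step have "\<bar>average m (ball y (R / 2 ^ Suc k)) u - average m (ball x (4 * R)) u\<bar> \<le> 5 * X"
      by linarith
    also have "\<dots> \<le> 4 * X * (Cd / 2)"
      using mult_left_mono[of 4 Cd X] X Cd by (simp add: mult.commute)
    also have "\<dots> = 4 * CP * Cd ^ 3 * (R * I / ?V) * (Cd / 2) ^ Suc k"
      unfolding X_def power_Suc by (simp only: mult_ac)
    finally show ?case .
  qed
qed

section \<open>The price of separating two sets\<close>

lemma sets_near: "{p. dist (fst p) (snd p) < r} \<in> sets (m \<Otimes>\<^sub>M m)"
proof -
  have "open {p::'a \<times> 'a. dist (fst p) (snd p) < r}"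
    by (intro open_Collect_less continuous_intros)
  then have "{p::'a \<times> 'a. dist (fst p) (snd p) < r} \<in> sets (borel \<Otimes>\<^sub>M borel)"
    unfolding borel_prod by (rule borel_open)
  then show ?thesis using sets_pair_measure_cong[OF sets_m sets_m] by simp
qed

lemma borel_measurable_measure_ball: "(\<lambda>y. measure m (ball y r)) \<in> borel_measurable m"
proof -
  interpret sigma_finite_measure m by (rule sigma_finite_m)
  have "(\<lambda>y. emeasure m (Pair y -` {p. dist (fst p) (snd p) < r})) \<in> borel_measurable m"
    by (rule measurable_emeasure_Pair[OF sets_near])
  also have "(\<lambda>y. emeasure m (Pair y -` {p. dist (fst p) (snd p) < r})) = (\<lambda>y. emeasure m (ball y r))"
    by (simp add: vimage_def ball_def)
  finally show ?thesis unfolding measure_def by measurable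
qed

lemma borel_measurable_ball_average:
  assumes g: "g \<in> borel_measurable m"
  shows "(\<lambda>y. ennreal (1 / measure m (ball y r)) * (\<integral>\<^sup>+z\<in>ball y r. g z \<partial>m)) \<in> borel_measurable m"
proof -
  interpret M: sigma_finite_measure m by (rule sigma_finite_m)
  have "(\<lambda>p. g (snd p) * indicator {p. dist (fst p) (snd p) < r} p) \<in> borel_measurable (m \<Otimes>\<^sub>M m)"
    using g sets_near[of r] by measurable
  then have "(\<lambda>y. \<integral>\<^sup>+z. g z * indicator {p. dist (fst p) (snd p) < r} (y, z) \<partial>m) \<in> borel_measurable m"
    by (intro M.borel_measurable_nn_integral) (simp add: case_prod_beta')
  moreover have "(\<lambda>y. \<integral>\<^sup>+z. g z * indicator {p. dist (fst p) (snd p) < r} (y, z) \<partial>m)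
      = (\<lambda>y. \<integral>\<^sup>+z\<in>ball y r. g z \<partial>m)"
    by (intro ext nn_integral_cong) (auto simp: indicator_def)
  ultimately have "(\<lambda>y. \<integral>\<^sup>+z\<in>ball y r. g z \<partial>m) \<in> borel_measurable m" by simp
  moreover have "(\<lambda>y. ennreal (1 / measure m (ball y r))) \<in> borel_measurable m"
    using borel_measurable_measure_ball[of r] by measurable
  ultimately show ?thesis by (intro borel_measurable_times_ennreal)
qed

text \<open>
  Fubini's theorem on the symmetric set \<open>{(y, z). d(y, z) < r}\<close>.
\<close>

lemma nn_integral_ball_averages:
  assumes g: "g \<in> borel_measurable m"
  shows "(\<integral>\<^sup>+y. ennreal (1 / measure m (ball y r)) * (\<integral>\<^sup>+z\<in>ball y r. g z \<partial>m) \<partial>m)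
       = (\<integral>\<^sup>+z. g z * (\<integral>\<^sup>+y\<in>ball z r. ennreal (1 / measure m (ball y r)) \<partial>m) \<partial>m)"
proof -
  interpret M: sigma_finite_measure m by (rule sigma_finite_m)
  interpret P: pair_sigma_finite m m ..
  define q where "q y = ennreal (1 / measure m (ball y r))" for y
  define D where "D = {p::'a \<times> 'a. dist (fst p) (snd p) < r}"
  have q: "q \<in> borel_measurable m"
    unfolding q_def using borel_measurable_measure_ball by measurable
  have D: "D \<in> sets (m \<Otimes>\<^sub>M m)" unfolding D_def by (rule sets_near)
  have b: "ball z r \<in> sets m" for z by (simp add: sets_m)
  have "(\<lambda>p. q (fst p) * (g (snd p) * indicator D p)) \<in> borel_measurable (m \<Otimes>\<^sub>M m)"
    using q g D by measurable
  then have meas: "(\<lambda>(y, z). q y * (g z * indicator D (y, z))) \<in> borel_measurable (m \<Otimes>\<^sub>M m)"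
    by (simp add: case_prod_beta')
  have "(\<integral>\<^sup>+y. q y * (\<integral>\<^sup>+z\<in>ball y r. g z \<partial>m) \<partial>m)
      = (\<integral>\<^sup>+y. (\<integral>\<^sup>+z. q y * (g z * indicator D (y, z)) \<partial>m) \<partial>m)"
    by (intro nn_integral_cong,
        subst nn_integral_cmult[symmetric, OF borel_measurable_times_ennreal[OF g borel_measurable_indicator[OF b]]])
       (auto simp: D_def indicator_def intro!: nn_integral_cong)
  also have "\<dots> = (\<integral>\<^sup>+z. (\<integral>\<^sup>+y. q y * (g z * indicator D (y, z)) \<partial>m) \<partial>m)"
    using P.Fubini'[OF meas] by simp
  also have "\<dots> = (\<integral>\<^sup>+z. g z * (\<integral>\<^sup>+y\<in>ball z r. q y \<partial>m) \<partial>m)"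
    by (intro nn_integral_cong,
        subst nn_integral_cmult[symmetric, OF borel_measurable_times_ennreal[OF q borel_measurable_indicator[OF b]]])
       (auto simp: D_def indicator_def dist_commute mult_ac intro!: nn_integral_cong)
  finally show ?thesis unfolding q_def .
qed

text \<open>
  The measures of \<open>B(y, r)\<close> and \<open>B(z, r)\<close> are comparable when \<open>d(y, z) < r\<close>. Together with
  \<open>nn_integral_ball_averages\<close> this replaces coverings by balls with bounded overlap.
\<close>

lemma ball_weight_bounds:
  assumes r: "r > 0"
  shows "(\<integral>\<^sup>+y\<in>ball z r. ennreal (1 / measure m (ball y r)) \<partial>m) \<le> ennreal Cd"
    and "ennreal (1 / Cd) \<le> (\<integral>\<^sup>+y\<in>ball z r. ennreal (1 / measure m (ball y r)) \<partial>m)"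
proof -
  let ?V = "measure m (ball z r)"
  have V: "?V > 0" using r by (rule ball_pos)
  have bz: "ball z r \<in> sets m" by (simp add: sets_m)
  have const: "(\<integral>\<^sup>+y\<in>ball z r. ennreal c \<partial>m) = ennreal (c * ?V)" if "c \<ge> 0" for c
    using bz that V by (simp add: nn_integral_cmult_indicator emeasure_ball ennreal_mult')
  have up: "1 / measure m (ball y r) \<le> Cd / ?V" and lo: "1 / (Cd * ?V) \<le> 1 / measure m (ball y r)"
    if "y \<in> ball z r" for y
  proof -
    have "?V \<le> Cd * measure m (ball y r)" "measure m (ball y r) \<le> Cd * ?V"
      using that by (auto intro!: ball_nearby[OF r] simp: dist_commute)
    then show "1 / measure m (ball y r) \<le> Cd / ?V" "1 / (Cd * ?V) \<le> 1 / measure m (ball y r)"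
      using V ball_pos[OF r, of y] Cd by (simp_all add: field_simps)
  qed
  have "(\<integral>\<^sup>+y\<in>ball z r. ennreal (1 / measure m (ball y r)) \<partial>m) \<le> (\<integral>\<^sup>+y\<in>ball z r. ennreal (Cd / ?V) \<partial>m)"
    using up by (intro nn_integral_mono) (auto simp: indicator_def intro!: ennreal_leI)
  also have "\<dots> = ennreal Cd" using V Cd by (subst const) auto
  finally show "(\<integral>\<^sup>+y\<in>ball z r. ennreal (1 / measure m (ball y r)) \<partial>m) \<le> ennreal Cd" .
  have "ennreal (1 / Cd) = (\<integral>\<^sup>+y\<in>ball z r. ennreal (1 / (Cd * ?V)) \<partial>m)"
    using V Cd by (subst const) auto
  also have "\<dots> \<le> (\<integral>\<^sup>+y\<in>ball z r. ennreal (1 / measure m (ball y r)) \<partial>m)"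
    using lo by (intro nn_integral_mono) (auto simp: indicator_def intro!: ennreal_leI)
  finally show "ennreal (1 / Cd) \<le> (\<integral>\<^sup>+y\<in>ball z r. ennreal (1 / measure m (ball y r)) \<partial>m)" .
qed

text \<open>
  If \<open>u\<close> deviates on \<open>F\<close> from its averages at scale \<open>\<rho>\<close>, then the Poincare inequality on \<open>B(y, \<rho>)\<close> bounds
  the proportion of \<open>F\<close> in \<open>B(y, \<rho>)\<close> by \<open>\<rho>\<close> times the mean slope on \<open>B(y, \<Lambda>\<rho>)\<close>. Integration over all
  centres \<open>y\<close> turns the first into the measure of \<open>F\<close> and the second into \<open>\<rho>\<close> times the total slope,
  up to powers of \<open>Cd\<close>.
\<close>

lemma measure_oscillation_le:
  assumes u: "locally_Lipschitz_on UNIV u" and I: "I \<ge> 0" "(\<integral>\<^sup>+y. lip u y \<partial>m) \<le> ennreal I"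
    and \<rho>: "\<rho> > 0" and F: "F \<in> sets borel" "bounded F"
    and osc: "\<And>y z. z \<in> F \<Longrightarrow> dist y z < \<rho> \<Longrightarrow> 1 / 8 \<le> \<bar>u z - average m (ball y \<rho>) u\<bar>"
  shows "measure m F \<le> 8 * Cd\<^sup>2 * CP * \<rho> * I"
proof -
  define q where "q r y = ennreal (1 / measure m (ball y r))" for r y
  have cont: "continuous_on UNIV u" by (rule locally_Lipschitz_on_UNIV_continuous[OF u])
  have lip: "lip u \<in> borel_measurable m"
    unfolding borel_measurable_m by (rule borel_measurable_lip[OF cont])
  have Fm: "F \<in> sets m" using F by (simp add: sets_m)
  have \<Lambda>\<rho>: "\<Lambda> * \<rho> > 0" using \<Lambda> \<rho> by auto
  have loc: "ennreal (1/8) * (q \<rho> y * (\<integral>\<^sup>+z\<in>ball y \<rho>. indicator F z \<partial>m))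
      \<le> ennreal (CP * \<rho>) * (q (\<Lambda> * \<rho>) y * (\<integral>\<^sup>+z\<in>ball y (\<Lambda> * \<rho>). lip u z \<partial>m))" for y
  proof -
    have inv: "x / emeasure m (ball y r) = q r y * x" if "r > 0" for x r
      using ball_pos[OF that, of y]
      by (simp add: q_def emeasure_ball divide_ennreal_def inverse_ennreal mult.commute inverse_eq_divide)
    have "ennreal (1/8) * (\<integral>\<^sup>+z\<in>ball y \<rho>. indicator F z \<partial>m)
        = (\<integral>\<^sup>+z. ennreal (1/8) * (indicator F z * indicator (ball y \<rho>) z) \<partial>m)"
      using Fm by (intro nn_integral_cmult[symmetric] borel_measurable_times_ennreal borel_measurable_indicator)
         (auto simp: sets_m)
    also have "\<dots> \<le> (\<integral>\<^sup>+z\<in>ball y \<rho>. ennreal \<bar>u z - average m (ball y \<rho>) u\<bar> \<partial>m)"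
      using osc by (intro nn_integral_mono) (auto simp: indicator_def intro!: ennreal_leI)
    finally have "q \<rho> y * (ennreal (1/8) * (\<integral>\<^sup>+z\<in>ball y \<rho>. indicator F z \<partial>m))
        \<le> q \<rho> y * (\<integral>\<^sup>+z\<in>ball y \<rho>. ennreal \<bar>u z - average m (ball y \<rho>) u\<bar> \<partial>m)"
      by (intro mult_left_mono) auto
    also have "\<dots> \<le> q (\<Lambda> * \<rho>) y * ennreal (CP * \<rho>) * (\<integral>\<^sup>+z\<in>ball y (\<Lambda> * \<rho>). lip u z \<partial>m)"
      using Poincare[OF u \<rho>, of y] unfolding inv[OF \<rho>] inv[OF \<Lambda>\<rho>] .
    finally show ?thesis by (simp add: mult_ac)
  qed
  have m1: "(\<lambda>y. q r y * (\<integral>\<^sup>+z\<in>ball y r. g z \<partial>m)) \<in> borel_measurable m"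
    if "g \<in> borel_measurable m" for g r
    unfolding q_def using that by (rule borel_measurable_ball_average)
  have Fi: "(indicator F :: 'a \<Rightarrow> ennreal) \<in> borel_measurable m" using Fm by measurable
  have "ennreal (1/8) * (ennreal (1/Cd) * emeasure m F)
      = ennreal (1/8) * (\<integral>\<^sup>+z. ennreal (1/Cd) * indicator F z \<partial>m)"
    using Fm by (simp add: nn_integral_cmult)
  also have "\<dots> \<le> ennreal (1/8) * (\<integral>\<^sup>+z. indicator F z * (\<integral>\<^sup>+y\<in>ball z \<rho>. q \<rho> y \<partial>m) \<partial>m)"
    using ball_weight_bounds(2)[OF \<rho>] unfolding q_def
    by (intro mult_left_mono nn_integral_mono) (auto simp: indicator_def)
  also have "\<dots> = ennreal (1/8) * (\<integral>\<^sup>+y. q \<rho> y * (\<integral>\<^sup>+z\<in>ball y \<rho>. indicator F z \<partial>m) \<partial>m)"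
    unfolding q_def using nn_integral_ball_averages[OF Fi, of \<rho>] by simp
  also have "\<dots> = (\<integral>\<^sup>+y. ennreal (1/8) * (q \<rho> y * (\<integral>\<^sup>+z\<in>ball y \<rho>. indicator F z \<partial>m)) \<partial>m)"
    by (intro nn_integral_cmult[symmetric] m1 Fi)
  also have "\<dots> \<le> (\<integral>\<^sup>+y. ennreal (CP * \<rho>) * (q (\<Lambda> * \<rho>) y * (\<integral>\<^sup>+z\<in>ball y (\<Lambda> * \<rho>). lip u z \<partial>m)) \<partial>m)"
    by (intro nn_integral_mono loc)
  also have "\<dots> = ennreal (CP * \<rho>) * (\<integral>\<^sup>+y. q (\<Lambda> * \<rho>) y * (\<integral>\<^sup>+z\<in>ball y (\<Lambda> * \<rho>). lip u z \<partial>m) \<partial>m)"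
    by (intro nn_integral_cmult m1 lip)
  also have "\<dots> = ennreal (CP * \<rho>) * (\<integral>\<^sup>+z. lip u z * (\<integral>\<^sup>+y\<in>ball z (\<Lambda> * \<rho>). q (\<Lambda> * \<rho>) y \<partial>m) \<partial>m)"
    unfolding q_def using nn_integral_ball_averages[OF lip, of "\<Lambda> * \<rho>"] by simp
  also have "\<dots> \<le> ennreal (CP * \<rho>) * (\<integral>\<^sup>+z. lip u z * ennreal Cd \<partial>m)"
    using ball_weight_bounds(1)[OF \<Lambda>\<rho>] unfolding q_def
    by (intro mult_left_mono nn_integral_mono) auto
  also have "\<dots> = ennreal (CP * \<rho>) * ((\<integral>\<^sup>+z. lip u z \<partial>m) * ennreal Cd)"
    using lip by (simp add: nn_integral_multc)
  also have "\<dots> \<le> ennreal (CP * \<rho>) * (ennreal I * ennreal Cd)"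
    using I by (intro mult_left_mono mult_right_mono) auto
  finally have "ennreal (1/8 * (1/Cd * measure m F)) \<le> ennreal (CP * \<rho> * (I * Cd))"
    using emeasure_bounded[OF F] Cd CP I \<rho> by (simp add: ennreal_mult'[symmetric])
  then have "1/8 * (1/Cd * measure m F) \<le> CP * \<rho> * (I * Cd)"
    using Cd CP I \<rho> by (subst (asm) ennreal_le_iff) auto
  then show ?thesis using Cd by (simp add: field_simps power2_eq_square)
qed

text \<open>
  If the first alternative fails, then by \<open>average_chain\<close> all averages of \<open>u\<close> over balls of radius
  \<open>R/2\<^sup>K\<close> in question lie within \<open>1/8\<close> of one constant. Whether this constant is at most \<open>1/2\<close> or not,
  \<open>u\<close> deviates from these averages by \<open>1/8\<close> on all of \<open>F1\<close> or on all of \<open>F0\<close>, and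
  \<open>measure_oscillation_le\<close> gives the second alternative.
\<close>

lemma separation_locally_Lipschitz:
  assumes u: "locally_Lipschitz_on UNIV u" and I: "I \<ge> 0" "(\<integral>\<^sup>+y. lip u y \<partial>m) \<le> ennreal I"
    and R: "R > 0"
    and F0: "F0 \<in> sets borel" "F0 \<subseteq> ball x R" "\<And>z. z \<in> F0 \<Longrightarrow> u z \<le> 1 / 4" "a \<le> measure m F0"
    and F1: "F1 \<in> sets borel" "F1 \<subseteq> ball x R" "\<And>z. z \<in> F1 \<Longrightarrow> u z \<ge> 3 / 4" "a \<le> measure m F1"
  shows "measure m (ball x R) \<le> 32 * CP * Cd ^ 3 * R * I * (Cd / 2) ^ K
    \<or> 2 ^ K * a \<le> 32 * CP * Cd ^ 3 * R * I"
proof -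
  have "2 ^ K * a \<le> 32 * CP * Cd ^ 3 * R * I" if "\<not> measure m (ball x R) \<le> 32 * CP * Cd ^ 3 * R * I * (Cd / 2) ^ K"
  proof -
  let ?V = "measure m (ball x R)" and ?\<rho> = "R / 2 ^ K" and ?c = "average m (ball x (4 * R)) u"
  from that have "4 * CP * Cd ^ 3 * (R * I / ?V) * (Cd / 2) ^ K \<le> 1 / 8"
    using ball_pos[OF R, of x] by (simp add: field_simps)
  then have avg: "\<bar>average m (ball y ?\<rho>) u - ?c\<bar> \<le> 1 / 8" if "dist x y < 2 * R" for y
    using average_chain[OF u I R that, of K] by linarith
  have \<rho>: "0 < ?\<rho>" "?\<rho> \<le> R" using R by (auto simp: field_simps)
  have near: "dist x y < 2 * R" if "z \<in> ball x R" "dist y z < ?\<rho>" for y z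
    using that \<rho>(2) dist_triangle[of x y z] by (simp add: dist_commute)
  have est: "a \<le> 8 * Cd\<^sup>2 * CP * ?\<rho> * I"
  proof (cases "?c \<le> 1 / 2")
    case True
    have "bounded F1" using F1(2) by (rule bounded_subset[OF bounded_ball])
    moreover have "1 / 8 \<le> \<bar>u z - average m (ball y ?\<rho>) u\<bar>" if "z \<in> F1" "dist y z < ?\<rho>" for y z
    proof -
      have "z \<in> ball x R" using that F1(2) by auto
      from avg[OF near[OF this that(2)]] F1(3)[OF that(1)] True show ?thesis by linarith
    qed
    ultimately have "measure m F1 \<le> 8 * Cd\<^sup>2 * CP * ?\<rho> * I"
      by (intro measure_oscillation_le[OF u I \<rho>(1) F1(1)])
    with F1(4) show ?thesis by simp
  next
    case False
    have "bounded F0" using F0(2) by (rule bounded_subset[OF bounded_ball])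
    moreover have "1 / 8 \<le> \<bar>u z - average m (ball y ?\<rho>) u\<bar>" if "z \<in> F0" "dist y z < ?\<rho>" for y z
    proof -
      have "z \<in> ball x R" using that F0(2) by auto
      from avg[OF near[OF this that(2)]] F0(3)[OF that(1)] False show ?thesis by linarith
    qed
    ultimately have "measure m F0 \<le> 8 * Cd\<^sup>2 * CP * ?\<rho> * I"
      by (intro measure_oscillation_le[OF u I \<rho>(1) F0(1)])
    with F0(4) show ?thesis by simp
  qed
  then have "2 ^ K * a \<le> 8 * (CP * Cd\<^sup>2 * R * I)" by (simp add: field_simps)
  also have "\<dots> \<le> 32 * (CP * Cd ^ 3 * R * I)"
    using CP R I Cd by (intro mult_mono mult_right_mono mult_left_mono power_increasing) auto
  finally show ?thesis by (simp add: mult_ac)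
  qed
  then show ?thesis by blast
qed

text \<open>
  An approximating locally Lipschitz function is within \<open>1/4\<close> of \<open>w\<close> on at least half of the
  measure \<open>a\<close> in each of the two sets.
\<close>

lemma separation_total_variation:
  assumes w: "w \<in> borel_measurable borel" and J: "J > 0" "total_variation_open m w UNIV < ennreal J"
    and R: "R > 0" and a: "a > 0"
    and F0: "F0 \<in> sets borel" "F0 \<subseteq> ball x R" "AE z in m. z \<in> F0 \<longrightarrow> w z = 0" "a \<le> measure m F0"
    and F1: "F1 \<in> sets borel" "F1 \<subseteq> ball x R" "AE z in m. z \<in> F1 \<longrightarrow> w z = 1" "a \<le> measure m F1"
  shows "measure m (ball x R) \<le> 32 * CP * Cd ^ 3 * R * J * (Cd / 2) ^ K
    \<or> 2 ^ K * (a / 2) \<le> 32 * CP * Cd ^ 3 * R * J"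
proof -
  obtain v where v: "\<And>n. locally_Lipschitz_on UNIV (v n)" "L1_loc_converges m UNIV v w"
      and lim: "liminf (\<lambda>n. \<integral>\<^sup>+x. lip (v n) x \<partial>m) < ennreal J"
    using J(2) unfolding total_variation_open_def by (auto simp: Inf_less_iff)
  have vm: "v n \<in> borel_measurable m" for n
    using locally_Lipschitz_on_UNIV_continuous[OF v(1)[of n]]
    unfolding borel_measurable_m by (rule borel_measurable_continuous_onI)
  have wm: "w \<in> borel_measurable m" using w unfolding borel_measurable_m .
  have bnd: "bounded F0" "bounded F1"
    using F0(2) F1(2) by (auto intro: bounded_subset[OF bounded_ball])
  have ev: "eventually (\<lambda>n. measure m {y \<in> F. 1/4 \<le> \<bar>v n y - w y\<bar>} < a / 2) sequentially"
    if "F \<in> sets borel" "bounded F" for F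
    using a that by (intro L1_loc_converges_in_measure[OF sets_m _ _ vm wm v(2)] finite_on_bounded) auto
  have "eventually (\<lambda>n. measure m {y \<in> F0. 1/4 \<le> \<bar>v n y - w y\<bar>} < a / 2
      \<and> measure m {y \<in> F1. 1/4 \<le> \<bar>v n y - w y\<bar>} < a / 2) sequentially"
    using ev[OF F0(1) bnd(1)] ev[OF F1(1) bnd(2)] by (rule eventually_conj)
  moreover have "\<not> eventually (\<lambda>n. ennreal J \<le> (\<integral>\<^sup>+x. lip (v n) x \<partial>m)) sequentially"
    using lim by (metis Liminf_bounded not_le)
  ultimately have "\<exists>n. (measure m {y \<in> F0. 1/4 \<le> \<bar>v n y - w y\<bar>} < a / 2
      \<and> measure m {y \<in> F1. 1/4 \<le> \<bar>v n y - w y\<bar>} < a / 2) \<and> \<not> ennreal J \<le> (\<integral>\<^sup>+x. lip (v n) x \<partial>m)"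
    using eventually_mono by (smt (verit, ccfv_threshold))
  then obtain n where n: "measure m {y \<in> F0. 1/4 \<le> \<bar>v n y - w y\<bar>} < a / 2"
      "measure m {y \<in> F1. 1/4 \<le> \<bar>v n y - w y\<bar>} < a / 2"
      and nJ: "(\<integral>\<^sup>+x. lip (v n) x \<partial>m) \<le> ennreal J"
    by (auto simp: not_le intro: less_imp_le)
  have large: "a / 2 \<le> measure m {z \<in> F. \<bar>v n z - c\<bar> < 1/4}"
    if F: "F \<in> sets borel" "bounded F" "AE z in m. z \<in> F \<longrightarrow> w z = c" "a \<le> measure m F"
      and bad: "measure m {y \<in> F. 1/4 \<le> \<bar>v n y - w y\<bar>} < a / 2" for F c
  proof -
    let ?P = "{z \<in> F. \<bar>v n z - c\<bar> < 1/4}" and ?Q = "{y \<in> F. 1/4 \<le> \<bar>v n y - w y\<bar>}"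
    have "?P = F \<inter> {z \<in> space m. \<bar>v n z - c\<bar> < 1/4}" "?Q = F \<inter> {y \<in> space m. 1/4 \<le> \<bar>v n y - w y\<bar>}"
      by (auto simp: space_m)
    moreover have "F \<inter> {z \<in> space m. \<bar>v n z - c\<bar> < 1/4} \<in> sets m"
      "F \<inter> {y \<in> space m. 1/4 \<le> \<bar>v n y - w y\<bar>} \<in> sets m"
      using F(1) vm[of n] wm unfolding sets_m[symmetric] by measurable
    ultimately have PQ: "?P \<in> sets m" "?Q \<in> sets m" by simp_all
    have PQb: "bounded ?P" "bounded ?Q" using F(2) by (auto intro: bounded_subset)
    have "emeasure m F \<le> emeasure m (?P \<union> ?Q)"
      using F(3) PQ by (intro emeasure_mono_AE) (auto elim!: eventually_mono)
    then have "measure m F \<le> measure m (?P \<union> ?Q)"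
      using F(1,2) PQ PQb by (simp add: emeasure_bounded sets_m)
    also have "\<dots> \<le> measure m ?P + measure m ?Q" using PQ by (rule measure_Un_le)
    finally show ?thesis using bad F(4) by linarith
  qed
  have sets': "{z \<in> F. \<bar>v n z - c\<bar> < 1/4} \<in> sets borel" if "F \<in> sets borel" for F c
  proof -
    have "F \<inter> {z \<in> space m. \<bar>v n z - c\<bar> < 1/4} \<in> sets m"
      using that vm[of n] unfolding sets_m[symmetric] by measurable
    moreover have "{z \<in> F. \<bar>v n z - c\<bar> < 1/4} = F \<inter> {z \<in> space m. \<bar>v n z - c\<bar> < 1/4}"
      by (auto simp: space_m)
    ultimately show ?thesis by (simp add: sets_m)
  qed
  show ?thesis
  proof (rule separation_locally_Lipschitz[OF v(1) _ nJ R])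
    show "{z \<in> F0. \<bar>v n z - 0\<bar> < 1/4} \<in> sets borel" "{z \<in> F1. \<bar>v n z - 1\<bar> < 1/4} \<in> sets borel"
      by (rule sets'[OF F0(1)], rule sets'[OF F1(1)])
    show "a / 2 \<le> measure m {z \<in> F0. \<bar>v n z - 0\<bar> < 1/4}"
      by (rule large[OF F0(1) bnd(1) F0(3,4) n(1)])
    show "a / 2 \<le> measure m {z \<in> F1. \<bar>v n z - 1\<bar> < 1/4}"
      by (rule large[OF F1(1) bnd(2) F1(3,4) n(2)])
    show "v n z \<le> 1 / 4" if "z \<in> {z \<in> F0. \<bar>v n z - 0\<bar> < 1/4}" for z
    proof -
      from that have "\<bar>v n z\<bar> < 1 / 4" by simp
      then show ?thesis by linarith
    qed
    have "v n z \<ge> 3 / 4" if "\<bar>v n z - 1\<bar> < 1 / 4" for z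
      using that by linarith
    then show "v n z \<ge> 3 / 4" if "z \<in> {z \<in> F1. \<bar>v n z - 1\<bar> < 1/4}" for z
      using that by blast
  qed (use F0(2) F1(2) J(1) in auto)
qed

section \<open>Connectedness and reverse doubling\<close>

text \<open>
  Otherwise the indicator of \<open>B(x, a)\<close> would be locally Lipschitz with slope \<open>0\<close>, and would separate
  two balls of positive measure at no cost.
\<close>

lemma annulus_nonempty:
  fixes x z :: 'a
  assumes ab: "0 < a" "a < b" and z: "dist x z \<ge> b"
  shows "\<exists>y. a \<le> dist x y \<and> dist x y < b"
proof (rule ccontr)
  assume "\<not> ?thesis"
  then have empty: "dist x y < a \<or> b \<le> dist x y" for y by (meson not_le)
  define u :: "'a \<Rightarrow> real" where "u = indicator (ball x a)"
  have loc: "u y = u w" if "dist y w < b - a" for y w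
    using empty[of y] empty[of w] that dist_triangle[of x y w] dist_triangle[of x w y]
    by (auto simp: u_def indicator_def dist_commute)
  have u: "locally_Lipschitz_on UNIV u"
    unfolding locally_Lipschitz_on_def
  proof (intro ballI exI conjI)
    fix y
    show "0 < (b - a) / 2" using ab by simp
    have eq: "u z = u w" if "z \<in> ball y ((b - a) / 2)" "w \<in> ball y ((b - a) / 2)" for z w
      using that dist_triangle[of z w y] by (intro loc) (auto simp: dist_commute)
    show "0-lipschitz_on (ball y ((b - a) / 2) \<inter> UNIV) u"
    proof (rule lipschitz_onI)
      fix z w assume "z \<in> ball y ((b - a) / 2) \<inter> UNIV" "w \<in> ball y ((b - a) / 2) \<inter> UNIV"
      then show "dist (u z) (u w) \<le> 0 * dist z w" using eq[of z w] by simp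
    qed simp
  qed
  have "lip u y = 0" for y
  proof (rule lip_locally_constant)
    show "open (ball y (b - a))" "y \<in> ball y (b - a)" using ab by auto
    show "u w = u y" if "w \<in> ball y (b - a)" for w
      using that by (intro loc) (auto simp: dist_commute)
  qed
  then have lip0: "(\<integral>\<^sup>+y. lip u y \<partial>m) \<le> ennreal 0" by simp
  \<comment> \<open>with total slope \<open>0\<close> both alternatives of the separation lemma fail\<close>
  define R where "R = dist x z + b"
  define c where "c = min (measure m (ball z (b - a))) (measure m (ball x a))"
  have c: "c > 0" unfolding c_def using ab by (auto intro!: ball_pos)
  have R: "R > 0" using ab by (simp add: R_def add_nonneg_pos)
  have zb: "u w = 0" if "w \<in> ball z (b - a)" for w
    using loc[of w z] that z ab by (auto simp: u_def dist_commute)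
  have "measure m (ball x R) \<le> 32 * CP * Cd ^ 3 * R * 0 * (Cd / 2) ^ 0 \<or> 2 ^ 0 * c \<le> 32 * CP * Cd ^ 3 * R * 0"
  proof (rule separation_locally_Lipschitz[OF u _ lip0 R])
    show "ball z (b - a) \<subseteq> ball x R"
    proof
      fix w assume "w \<in> ball z (b - a)"
      then show "w \<in> ball x R" using ab dist_triangle[of x w z] by (simp add: R_def)
    qed
    show "ball x a \<subseteq> ball x R" using ab by (intro subset_ball) (simp add: R_def add_increasing)
    show "c \<le> measure m (ball z (b - a))" "c \<le> measure m (ball x a)" by (auto simp: c_def)
    show "u w \<le> 1 / 4" if "w \<in> ball z (b - a)" for w using zb[OF that] by simp
    show "3 / 4 \<le> u w" if "w \<in> ball x a" for w using that by (simp add: u_def)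
  qed auto
  with ball_pos[OF R, of x] c show False by simp
qed

text \<open>
  A ball of radius \<open>s/4\<close> centred at distance about \<open>3s/2\<close> from \<open>x\<close> fits between \<open>B(x, s)\<close> and \<open>B(x, 2s)\<close>
  and has a fixed proportion of the measure of \<open>B(x, 2s)\<close>.
\<close>

lemma reverse_doubling:
  assumes s: "s > 0" and z: "dist x z \<ge> 7 / 4 * s"
  shows "(1 + 1 / Cd ^ 4) * measure m (ball x s) \<le> measure m (ball x (2 * s))"
proof -
  obtain y where y: "5 / 4 * s \<le> dist x y" "dist x y < 7 / 4 * s"
    using annulus_nonempty[of "5 / 4 * s" "7 / 4 * s" x z] s z by auto
  have "ball x (2 * s) \<subseteq> ball y (4 * s)"
  proof
    fix w assume "w \<in> ball x (2 * s)"
    then show "w \<in> ball y (4 * s)" using y s dist_triangle[of y w x] by (simp add: dist_commute)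
  qed
  then have "measure m (ball x (2 * s)) \<le> measure m (ball y (4 * s))" by (rule ball_mono)
  also have "\<dots> \<le> Cd ^ 4 * measure m (ball y (4 * s / 2 ^ 4))" using s by (intro ball_double_power) auto
  finally have small: "1 / Cd ^ 4 * measure m (ball x (2 * s)) \<le> measure m (ball y (s / 4))"
    using Cd by (simp add: field_simps)
  have in2: "ball x s \<union> ball y (s / 4) \<subseteq> ball x (2 * s)"
  proof
    fix w assume "w \<in> ball x s \<union> ball y (s / 4)"
    then show "w \<in> ball x (2 * s)" using y s dist_triangle[of x w y] by (auto simp: dist_commute)
  qed
  have disj: "ball x s \<inter> ball y (s / 4) = {}"
  proof -
    have False if "dist x w < s" "dist y w < s / 4" for w
      using that y dist_triangle[of x y w] by (simp add: dist_commute)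
    then show ?thesis by auto
  qed
  have "measure m (ball x s) + measure m (ball y (s / 4)) = measure m (ball x s \<union> ball y (s / 4))"
    using disj fmeasurable_bounded[of "ball x s"] fmeasurable_bounded[of "ball y (s / 4)"]
    by (simp add: measure_Un3)
  also have "\<dots> \<le> measure m (ball x (2 * s))"
    using in2 by (intro measure_mono_bounded) auto
  finally have "measure m (ball x s) + 1 / Cd ^ 4 * measure m (ball x (2 * s)) \<le> measure m (ball x (2 * s))"
    using small by linarith
  moreover have "1 / Cd ^ 4 * measure m (ball x s) \<le> 1 / Cd ^ 4 * measure m (ball x (2 * s))"
    using s Cd by (intro mult_left_mono ball_mono subset_ball) auto
  ultimately show ?thesis by (simp add: algebra_simps)
qed

section \<open>Extending cutoff functions\<close>

lemma nn_integral_measure_restr: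
  assumes "B \<in> sets borel" "g \<in> borel_measurable borel"
  shows "(\<integral>\<^sup>+x. g x \<partial>measure_restr m B) = (\<integral>\<^sup>+x. indicator B x * g x \<partial>m)"
  using assms unfolding measure_restr_def
  by (intro nn_integral_density) (simp_all add: borel_measurable_m sets_m)

lemma BV_norm_cutoff:
  assumes E: "E \<in> sets borel" and L: "L \<ge> 0" "L-lipschitz_on UNIV u"
    and u: "\<And>y. \<bar>u y\<bar> \<le> indicator (ball x t) y" "\<And>y. lip u y \<le> ennreal L * indicator (ball x t) y"
  shows "u \<in> BV m E" "BV_norm m E u \<le> ennreal ((1 + L) * measure m (ball x t \<inter> E))"
proof -
  let ?f = "measure m (ball x t \<inter> E)"
  have cont: "continuous_on UNIV u" using L(2) by (rule lipschitz_on_continuous_on)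
  have um: "u \<in> borel_measurable borel" using cont by (rule borel_measurable_continuous_onI)
  have bE: "ball x t \<inter> E \<in> sets borel" "bounded (ball x t \<inter> E)" using E by auto
  have const: "(\<integral>\<^sup>+y. indicator E y * (ennreal c * indicator (ball x t) y) \<partial>m) = ennreal (c * ?f)" if "c \<ge> 0" for c
  proof -
    have "(\<integral>\<^sup>+y. indicator E y * (ennreal c * indicator (ball x t) y) \<partial>m)
        = (\<integral>\<^sup>+y. ennreal c * indicator (ball x t \<inter> E) y \<partial>m)"
      by (intro nn_integral_cong) (auto simp: indicator_def)
    also have "\<dots> = ennreal c * emeasure m (ball x t \<inter> E)"
      using bE by (intro nn_integral_cmult_indicator) (simp add: sets_m)
    also have "\<dots> = ennreal (c * ?f)" using that bE by (simp add: emeasure_bounded ennreal_mult')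
    finally show ?thesis .
  qed
  have "(\<integral>\<^sup>+y. ennreal \<bar>u y\<bar> \<partial>measure_restr m E) = (\<integral>\<^sup>+y. indicator E y * ennreal \<bar>u y\<bar> \<partial>m)"
    using E um by (intro nn_integral_measure_restr) auto
  also have "\<dots> \<le> (\<integral>\<^sup>+y. indicator E y * (ennreal 1 * indicator (ball x t) y) \<partial>m)"
  proof (intro nn_integral_mono mult_left_mono)
    fix y show "ennreal \<bar>u y\<bar> \<le> ennreal 1 * indicator (ball x t) y"
      using ennreal_leI[OF u(1)[of y]] by (cases "y \<in> ball x t") auto
  qed auto
  also have "\<dots> = ennreal ?f" by (subst const) auto
  finally have l1: "(\<integral>\<^sup>+y. ennreal \<bar>u y\<bar> \<partial>measure_restr m E) \<le> ennreal ?f" .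
  have "total_variation (measure_restr m E) u E \<le> total_variation_open (measure_restr m E) u UNIV"
    unfolding total_variation_def by (intro Inf_lower) auto
  also have "\<dots> \<le> liminf (\<lambda>n. \<integral>\<^sup>+x\<in>UNIV. lip u x \<partial>measure_restr m E)"
    unfolding total_variation_open_def
    by (intro Inf_lower CollectI exI[of _ "\<lambda>_. u"])
       (auto simp: L1_loc_converges_def intro!: Lipschitz_imp_locally[OF L(2)] exI[of _ "1::real"])
  also have "\<dots> = (\<integral>\<^sup>+x. indicator E x * lip u x \<partial>m)"
    using nn_integral_measure_restr[OF E borel_measurable_lip[OF cont]] by (simp add: Liminf_const)
  also have "\<dots> \<le> (\<integral>\<^sup>+y. indicator E y * (ennreal L * indicator (ball x t) y) \<partial>m)"
    by (intro nn_integral_mono mult_left_mono u) auto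
  also have "\<dots> = ennreal (L * ?f)" using L by (subst const) auto
  finally have tv: "total_variation (measure_restr m E) u E \<le> ennreal (L * ?f)" .
  have "integrable (measure_restr m E) u"
  proof (rule integrableI_bounded)
    show "u \<in> borel_measurable (measure_restr m E)"
      using um by (simp add: measure_restr_def borel_measurable_m)
    show "(\<integral>\<^sup>+y. ennreal (norm (u y)) \<partial>measure_restr m E) < \<infinity>"
      using le_less_trans[OF l1] by (simp add: ennreal_less_top)
  qed
  with tv show "u \<in> BV m E" by (simp add: BV_def le_less_trans[OF tv] ennreal_less_top)
  have "BV_norm m E u \<le> ennreal ?f + ennreal (L * ?f)"
    unfolding BV_norm_def using l1 tv by (rule add_mono)
  also have "\<dots> = ennreal ((1 + L) * ?f)" using L by (simp add: ennreal_plus[symmetric] algebra_simps del: ennreal_plus)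
  finally show "BV_norm m E u \<le> ennreal ((1 + L) * ?f)" .
qed

text \<open>
  The extended cutoff function separates \<open>E \<inter> B(x, s)\<close> from \<open>E \<inter> B(x, 2R) - B(x, t)\<close>. The growth
  hypothesis provides a second set of measure comparable to the first.
\<close>

lemma extension_measure_decay:
  assumes E: "E \<in> sets borel" and C: "C \<ge> 1"
    and T: "\<And>u. u \<in> BV m E \<Longrightarrow> T u \<in> BV m UNIV \<and> (AE x in m. x \<in> E \<longrightarrow> T u x = u x) \<and>
        BV_norm m UNIV (T u) \<le> ennreal C * BV_norm m E u"
    and st: "0 < s" "s < t" "t \<le> R" "R \<le> D" and \<eta>: "0 < \<eta>" "\<eta> \<le> 1"
    and fs: "measure m (ball x s \<inter> E) > 0"
    and grow: "(1 + \<eta>) * measure m (ball x R \<inter> E) \<le> measure m (ball x (2 * R) \<inter> E)"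
  shows "measure m (ball x (2 * R)) * (t - s)
      \<le> 256 * CP * Cd ^ 3 * C * (D + 2) / \<eta> * R * measure m (ball x t \<inter> E) * (Cd / 2) ^ K
    \<or> 2 ^ K * measure m (ball x s \<inter> E) * (t - s)
      \<le> 256 * CP * Cd ^ 3 * C * (D + 2) / \<eta> * R * measure m (ball x t \<inter> E)"
proof -
  define f where "f r = measure m (ball x r \<inter> E)" for r
  define A where "A = 32 * CP * Cd ^ 3"
  have A: "A > 0" using CP Cd by (simp add: A_def)
  have f_mono: "f r \<le> f r'" if "r \<le> r'" for r r'
    unfolding f_def using E that by (intro measure_mono_bounded) auto
  have fs': "f s > 0" using fs by (simp add: f_def)
  have ft: "f t > 0" using fs' f_mono[of s t] st by auto
  obtain u where u: "(2 / (t - s))-lipschitz_on UNIV u"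
    "\<And>y. y \<in> ball x s \<Longrightarrow> u y = 1" "\<And>y. y \<notin> ball x t \<Longrightarrow> u y = 0"
    "\<And>y. \<bar>u y\<bar> \<le> indicator (ball x t) y"
    "\<And>y. lip u y \<le> ennreal (2 / (t - s)) * indicator (ball x t) y"
    using Lipschitz_cutoff[OF st(1,2), of x] by blast
  have bv: "u \<in> BV m E" "BV_norm m E u \<le> ennreal ((1 + 2 / (t - s)) * f t)"
    using BV_norm_cutoff[OF E _ u(1,4,5)] st unfolding f_def by auto
  define w where "w = T u"
  \<comment> \<open>twice the bound on the norm, so that the total variation lies strictly below \<open>J\<close>\<close>
  define J where "J = 2 * C * (1 + 2 / (t - s)) * f t"
  have J: "J > 0" unfolding J_def using C st ft by (intro mult_pos_pos add_pos_pos divide_pos_pos) auto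
  have w: "w \<in> BV m UNIV" "AE x in m. x \<in> E \<longrightarrow> w x = u x"
      "BV_norm m UNIV w \<le> ennreal C * BV_norm m E u"
    using T[OF bv(1)] by (auto simp: w_def)
  have wm: "w \<in> borel_measurable borel"
    using w(1) by (auto simp: BV_def measure_restr_UNIV borel_measurable_m[symmetric] dest: borel_measurable_integrable)
  have "total_variation_open m w UNIV \<le> total_variation m w UNIV"
    unfolding total_variation_def by (rule Inf_greatest) (auto simp: top.extremum_unique)
  also have "\<dots> \<le> BV_norm m UNIV w" by (simp add: BV_norm_def measure_restr_UNIV)
  also note w(3)
  also have "ennreal C * BV_norm m E u \<le> ennreal C * ennreal ((1 + 2 / (t - s)) * f t)"
    by (intro mult_left_mono bv(2)) auto
  also have "\<dots> = ennreal (C * ((1 + 2 / (t - s)) * f t))" using C by (intro ennreal_mult'[symmetric]) auto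
  also have "C * ((1 + 2 / (t - s)) * f t) = J / 2" unfolding J_def by simp
  also have "\<dots> < ennreal J" using J by (simp add: ennreal_less_iff)
  finally have tv: "total_variation_open m w UNIV < ennreal J" .
  let ?F0 = "(ball x (2 * R) - ball x t) \<inter> E" and ?F1 = "ball x s \<inter> E"
  have R: "R > 0" using st by auto
  have disj: "measure m (ball x (2 * R)) \<le> A * (2 * R) * J * (Cd / 2) ^ K \<or> 2 ^ K * (\<eta> * f s / 2) \<le> A * (2 * R) * J"
    unfolding A_def
  proof (rule separation_total_variation[OF wm J tv])
    show "?F0 \<in> sets borel" "?F1 \<in> sets borel" using E by auto
    show "?F0 \<subseteq> ball x (2 * R)" "?F1 \<subseteq> ball x (2 * R)" using st by auto
    show "AE z in m. z \<in> ?F0 \<longrightarrow> w z = 0" using w(2) by (rule eventually_mono) (use u(3) in auto)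
    show "AE z in m. z \<in> ?F1 \<longrightarrow> w z = 1" using w(2) by (rule eventually_mono) (use u(2) in auto)
    show "\<eta> * f s \<le> measure m ?F1" using \<eta> fs' by (simp add: f_def mult_left_le_one_le)
    have "f (2 * R) = measure m (?F0 \<union> (ball x t \<inter> E))"
      unfolding f_def using st by (intro arg_cong[where f = "measure m"]) auto
    also have "\<dots> \<le> measure m ?F0 + f t"
      unfolding f_def using E by (intro measure_Un_le) (auto simp: sets_m)
    finally have "f (2 * R) - f t \<le> measure m ?F0" by simp
    moreover have "f t \<le> f R" "f s \<le> f R" using st by (auto intro!: f_mono)
    moreover have "\<eta> * f s \<le> \<eta> * f R" using \<eta> \<open>f s \<le> f R\<close> by (intro mult_left_mono) auto
    ultimately show "\<eta> * f s \<le> measure m ?F0" using grow by (simp add: f_def algebra_simps)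
  qed (use R \<eta> fs' in auto)
  have "J * (t - s) = 2 * C * (t - s + 2) * f t" using st by (simp add: J_def field_simps)
  also have "\<dots> \<le> 2 * C * (D + 2) * f t"
    using st C ft by (intro mult_right_mono mult_left_mono) auto
  finally have Jts: "J * (t - s) \<le> 2 * C * (D + 2) * f t" .
  define Z where "Z = A * C * (D + 2) * R * f t"
  have Z: "Z > 0" unfolding Z_def using A C st R ft by (intro mult_pos_pos) auto
  have AJ: "A * (2 * R) * J * (t - s) \<le> 4 * Z"
    using mult_left_mono[OF Jts, of "A * (2 * R)"] A R by (simp add: Z_def mult_ac)
  have goal_eq: "256 * CP * Cd ^ 3 * C * (D + 2) / \<eta> * R * f t = 8 * Z / \<eta>"
    by (simp add: Z_def A_def)
  have "8 * Z \<le> 8 * Z / \<eta>" using \<eta> Z by (simp add: field_simps)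
  from disj show ?thesis
  proof
    assume "measure m (ball x (2 * R)) \<le> A * (2 * R) * J * (Cd / 2) ^ K"
    then have "measure m (ball x (2 * R)) * (t - s) \<le> A * (2 * R) * J * (Cd / 2) ^ K * (t - s)"
      using st by (intro mult_right_mono) auto
    also have "\<dots> = A * (2 * R) * J * (t - s) * (Cd / 2) ^ K" by (simp add: mult_ac)
    also have "\<dots> \<le> 8 * Z / \<eta> * (Cd / 2) ^ K"
    proof (rule mult_right_mono)
      show "A * (2 * R) * J * (t - s) \<le> 8 * Z / \<eta>"
        using AJ \<open>8 * Z \<le> 8 * Z / \<eta>\<close> Z by linarith
    qed (use Cd in auto)
    finally show ?thesis unfolding f_def[symmetric] goal_eq by blast
  next
    assume "2 ^ K * (\<eta> * f s / 2) \<le> A * (2 * R) * J"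
    then have "2 ^ K * (\<eta> * f s / 2) * (t - s) \<le> A * (2 * R) * J * (t - s)"
      using st by (intro mult_right_mono) auto
    also note AJ
    finally have "2 ^ K * f s * (t - s) \<le> 8 * Z / \<eta>" using \<eta> by (simp add: field_simps)
    then show ?thesis unfolding f_def[symmetric] goal_eq by blast
  qed
qed

text \<open>
  The De Giorgi iteration turns the decay into a density bound. The bound is uniform in the centre and in
  the scale, since the constant of \<open>extension_measure_decay\<close> depends on neither.
\<close>

lemma growth_imp_density:
  assumes E: "E \<in> sets borel" and C: "C \<ge> 1"
    and T: "\<And>u. u \<in> BV m E \<Longrightarrow> T u \<in> BV m UNIV \<and> (AE x in m. x \<in> E \<longrightarrow> T u x = u x) \<and>
        BV_norm m UNIV (T u) \<le> ennreal C * BV_norm m E u"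
    and D: "D \<ge> 0" and \<eta>: "0 < \<eta>" "\<eta> \<le> 1"
  shows "\<exists>c>0. \<forall>x R. 0 < R \<longrightarrow> R \<le> D \<longrightarrow> (\<forall>s>0. measure m (ball x s \<inter> E) > 0) \<longrightarrow>
      (1 + \<eta>) * measure m (ball x R \<inter> E) \<le> measure m (ball x (2 * R) \<inter> E) \<longrightarrow>
      c * measure m (ball x R) \<le> measure m (ball x R \<inter> E)"
proof -
  define B where "B = 256 * CP * Cd ^ 3 * C * (D + 2) / \<eta>"
  have B: "B > 0" unfolding B_def using CP Cd C D \<eta> by (intro divide_pos_pos mult_pos_pos) auto
  obtain K0 where K0: "8 * B * (Cd / 2) \<le> 2 ^ K0"
    using real_arch_pow[of 2 "8 * B * (Cd / 2)"] by (auto intro: less_imp_le)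
  define c where "c = 1 / (4 * B * (Cd / 2) ^ K0)"
  have c: "c > 0" unfolding c_def using B Cd by auto
  show ?thesis
  proof (intro exI conjI allI impI)
    fix x R assume R: "0 < R" "R \<le> D" and pos: "\<forall>s>0. measure m (ball x s \<inter> E) > 0"
      and grow: "(1 + \<eta>) * measure m (ball x R \<inter> E) \<le> measure m (ball x (2 * R) \<inter> E)"
    have "measure m (ball x (2 * R)) \<le> 4 * B * (Cd / 2) ^ K0 * measure m (ball x R \<inter> E)"
    proof (rule De_Giorgi_iteration[where f = "\<lambda>s. measure m (ball x s \<inter> E)", OF R(1) _ _ _ _ K0])
      show "measure m (ball x s \<inter> E) \<le> measure m (ball x t \<inter> E)" if "s \<le> t" for s t
        using E that by (intro measure_mono_bounded) auto
      show "measure m (ball x (2 * R)) * (t - s) \<le> B * R * measure m (ball x t \<inter> E) * (Cd / 2) ^ K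
        \<or> 2 ^ K * measure m (ball x s \<inter> E) * (t - s) \<le> B * R * measure m (ball x t \<inter> E)"
        if "0 < s" "s < t" "t \<le> R" for s t K
        unfolding B_def by (rule extension_measure_decay[OF E C T that R(2) \<eta> _ grow]) (use pos that in auto)
    qed (use pos B Cd in auto)
    moreover have "measure m (ball x R) \<le> measure m (ball x (2 * R))"
      using R by (intro ball_mono subset_ball) auto
    ultimately have "measure m (ball x R) \<le> 4 * B * (Cd / 2) ^ K0 * measure m (ball x R \<inter> E)" by linarith
    then show "c * measure m (ball x R) \<le> measure m (ball x R \<inter> E)"
      unfolding c_def using B Cd by (simp add: field_simps)
  qed (rule c)
qed

section \<open>Measure density of extension sets\<close>

lemma not_density_zero_point_imp_positive:
  assumes E: "E \<in> sets borel" and x: "x \<in> closure (UNIV - density_zero_points m E)" and r: "r > 0"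
  shows "emeasure m (ball x r \<inter> E) \<noteq> 0"
proof
  assume null: "emeasure m (ball x r \<inter> E) = 0"
  obtain y where y: "y \<notin> density_zero_points m E" "dist y x < r"
    using x r unfolding closure_approachable by blast
  have "eventually (\<lambda>\<rho>. emeasure m (ball y \<rho> \<inter> E) / emeasure m (ball y \<rho>) \<le> 0) (at_right 0)"
  proof -
    have "eventually (\<lambda>\<rho>. \<rho> < r - dist y x) (at_right 0)"
      using y(2) by (intro order_tendstoD tendsto_ident_at) auto
    then show ?thesis
    proof (rule eventually_mono)
      fix \<rho> assume \<rho>: "\<rho> < r - dist y x"
      have "ball y \<rho> \<subseteq> ball x r"
      proof
        fix z assume "z \<in> ball y \<rho>"
        then show "z \<in> ball x r" using \<rho> dist_triangle[of x z y] by (simp add: dist_commute)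
      qed
      then have "emeasure m (ball y \<rho> \<inter> E) \<le> emeasure m (ball x r \<inter> E)"
        using E by (intro emeasure_mono) (auto simp: sets_m)
      then show "emeasure m (ball y \<rho> \<inter> E) / emeasure m (ball y \<rho>) \<le> 0" using null by simp
    qed
  qed
  then have "Limsup (at_right (0::real)) (\<lambda>r. emeasure m (ball y r \<inter> E) / emeasure m (ball y r)) \<le> 0"
    by (rule Limsup_bounded)
  with y(1) show False by (simp add: density_zero_points_def)
qed

text \<open>
  Induction on the number of doublings needed to exceed the diameter of \<open>E\<close>, by the dichotomy
  between growth of \<open>f\<close> and reverse doubling of \<open>g\<close>.
\<close>

lemma extension_set_measure_density:
  assumes E: "E \<in> sets borel" "bounded E" "measure m E > 0" and C: "C \<ge> 1"
    and T: "\<And>u. u \<in> BV m E \<Longrightarrow> T u \<in> BV m UNIV \<and> (AE x in m. x \<in> E \<longrightarrow> T u x = u x) \<and>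
        BV_norm m UNIV (T u) \<le> ennreal C * BV_norm m E u"
  shows "\<exists>c>0. \<forall>x r. 0 < r \<longrightarrow> r < diameter E \<longrightarrow> (\<forall>s>0. measure m (ball x s \<inter> E) > 0) \<longrightarrow>
      c * measure m (ball x r) \<le> measure m (ball x r \<inter> E)"
proof -
  define D where "D = diameter E"
  define \<eta> where "\<eta> = 1 / Cd ^ 4"
  \<comment> \<open>the growth rate in \<open>reverse_doubling\<close>\<close>
  have D: "D \<ge> 0" unfolding D_def by (rule diameter_ge_0[OF E(2)])
  have \<eta>: "0 < \<eta>" "\<eta> \<le> 1" unfolding \<eta>_def using Cd one_le_power[of Cd 4] by auto
  obtain c1 where c1: "c1 > 0" and good: "\<And>x R. 0 < R \<Longrightarrow> R \<le> D \<Longrightarrow> \<forall>s>0. measure m (ball x s \<inter> E) > 0 \<Longrightarrow>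
      (1 + \<eta>) * measure m (ball x R \<inter> E) \<le> measure m (ball x (2 * R) \<inter> E) \<Longrightarrow>
      c1 * measure m (ball x R) \<le> measure m (ball x R \<inter> E)"
    using growth_imp_density[OF E(1) C T D \<eta>] by metis
  obtain e0 where e0: "e0 \<in> E" using E(3) by (cases "E = {}") auto
  define V0 where "V0 = measure m (ball e0 (4 * D + 1))"
  have V0: "V0 > 0" unfolding V0_def using D by (intro ball_pos) auto
  define c2 where "c2 = min c1 (measure m E / V0)"
  have c2: "c2 > 0" unfolding c2_def using c1 E(3) V0 by auto
  define c where "c = c2 / (1 + \<eta>) / (1 + \<eta>)"
  have shrink: "a / (1 + \<eta>) \<le> a" if "a \<ge> 0" for a using that \<eta> by (simp add: field_simps)
  have c: "c > 0" "c \<le> c2 / (1 + \<eta>)" "c2 / (1 + \<eta>) \<le> c2"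
    using shrink[of c2] shrink[of "c2 / (1 + \<eta>)"] c2 \<eta> by (simp_all only: c_def) auto
  show ?thesis
  proof (intro exI conjI allI impI)
    fix x r assume r: "0 < r" "r < diameter E" and pos: "\<forall>s>0. measure m (ball x s \<inter> E) > 0"
    define f where "f s = measure m (ball x s \<inter> E)" for s
    define g where "g s = measure m (ball x s)" for s
    have g_mono: "g s \<le> g t" if "s \<le> t" for s t unfolding g_def using that by (intro ball_mono subset_ball)
    have g_pos: "g s > 0" if "s > 0" for s unfolding g_def using that by (rule ball_pos)
    have D0: "D > 0" using r by (simp add: D_def)
    \<comment> \<open>points of \<open>E\<close> lie arbitrarily near \<open>x\<close>\<close>
    have close: "dist x e \<le> D" if "e \<in> E" for e
    proof (rule field_le_epsilon)
      fix \<epsilon> :: real assume "\<epsilon> > 0"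
      then have "ball x \<epsilon> \<inter> E \<noteq> {}" using pos by (metis less_irrefl measure_empty)
      then obtain y where "y \<in> E" "dist x y < \<epsilon>" by auto
      then show "dist x e \<le> D + \<epsilon>"
        using dist_triangle[of x e y] diameter_bounded_bound[OF E(2) \<open>y \<in> E\<close> that] by (simp add: D_def)
    qed
    have dich: "c1 * g s \<le> f s \<or> f (2 * s) \<le> (1 + \<eta>) * f s" if "0 < s" "s \<le> D" for s
      using good[OF that pos] unfolding f_def g_def by (meson linear)
    have large: "c2 * g s \<le> f s" if "D < s" "s \<le> 2 * D" for s
    proof -
      have "ball x s \<inter> E = E" using close that by fastforce
      then have "f s = measure m E" by (simp add: f_def)
      moreover have "g s \<le> V0"
        unfolding g_def V0_def
      proof (rule ball_mono, rule)
        fix w assume "w \<in> ball x s"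
        then show "w \<in> ball e0 (4 * D + 1)"
          using that D0 close[OF e0] dist_triangle[of e0 w x] by (simp add: dist_commute)
      qed
      then have "c2 * g s \<le> measure m E / V0 * V0"
        using g_pos[of s] that D0 V0 E(3) by (intro mult_mono) (auto simp: c2_def)
      ultimately show ?thesis using V0 by simp
    qed
    have step: "\<kappa> / (1 + \<eta>) * g s \<le> f s" if "0 < s" "s \<le> D" "\<kappa> * g (2 * s) \<le> f (2 * s)" "0 \<le> \<kappa>" "\<kappa> \<le> c1" for s \<kappa>
      using dich[OF that(1,2)]
    proof
      assume "c1 * g s \<le> f s"
      moreover have "\<kappa> / (1 + \<eta>) * g s \<le> c1 * g s"
        using that \<eta> g_pos[OF that(1)] by (intro mult_right_mono) (auto simp: field_simps add_increasing2)
      ultimately show ?thesis by linarith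
    next
      assume "f (2 * s) \<le> (1 + \<eta>) * f s"
      moreover have "\<kappa> * g s \<le> \<kappa> * g (2 * s)" using that by (intro mult_left_mono g_mono) auto
      ultimately have "\<kappa> * g s \<le> (1 + \<eta>) * f s" using that by linarith
      then show ?thesis using \<eta> by (simp add: field_simps)
    qed
    have c2c1: "c2 \<le> c1" by (simp add: c2_def)
    \<comment> \<open>between a quarter of the diameter and the diameter reverse doubling may fail, so that up to
      two factors \<open>1 + \<eta>\<close> are lost\<close>
    have mid: "c2 / (1 + \<eta>) * g s \<le> f s" if "D / 2 < s" "s \<le> D" for s
      using that D0 c2 c2c1 by (intro step large) auto
    have upper: "c * g s \<le> f s" if "D / 4 < s" "s \<le> D" for s
    proof (cases "D / 2 < s")
      case True
      have "c * g s \<le> c2 / (1 + \<eta>) * g s" using c g_pos[of s] that D0 by (intro mult_right_mono) auto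
      with mid[OF True that(2)] show ?thesis by linarith
    next
      case False
      have "c2 / (1 + \<eta>) / (1 + \<eta>) * g s \<le> f s"
        using that D0 c2 c2c1 c False \<eta> by (intro step mid) auto
      then show ?thesis by (simp add: c_def)
    qed
    have "c * g s \<le> f s" if "0 < s" "s \<le> D" "D < 2 ^ n * s" for s n
      using that
    proof (induction n arbitrary: s)
      case 0
      then show ?case by simp
    next
      case (Suc n)
      show ?case
      proof (cases "D / 4 < s")
        case True
        then show ?thesis using Suc.prems by (intro upper) auto
      next
        case False
        have IH: "c * g (2 * s) \<le> f (2 * s)" using Suc.prems False by (intro Suc.IH) (auto simp: mult_ac)
        have "7 / 2 * s < diameter E" using False Suc.prems by (simp add: D_def)
        then obtain y z :: 'a where "7 / 2 * s < dist y z"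
          using diameter_lower_bounded[OF E(2), of "7 / 2 * s"] Suc.prems by auto
        then have "7 / 4 * s \<le> dist x y \<or> 7 / 4 * s \<le> dist x z"
          using dist_triangle3[of y z x] by linarith
        then have rd: "(1 + \<eta>) * g s \<le> g (2 * s)"
          unfolding g_def \<eta>_def using reverse_doubling[OF Suc.prems(1)] by blast
        from dich[OF Suc.prems(1,2)] show ?thesis
        proof
          assume "c1 * g s \<le> f s"
          moreover have "c * g s \<le> c1 * g s"
            using c c2c1 g_pos[OF Suc.prems(1)] by (intro mult_right_mono) auto
          ultimately show ?thesis by linarith
        next
          assume "f (2 * s) \<le> (1 + \<eta>) * f s"
          moreover have "(1 + \<eta>) * (c * g s) \<le> c * g (2 * s)"
            using mult_left_mono[OF rd, of c] c(1) by (simp add: mult.left_commute)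
          ultimately have "(1 + \<eta>) * (c * g s) \<le> (1 + \<eta>) * f s" using IH by linarith
          then show ?thesis using \<eta> by (subst (asm) mult_le_cancel_left_pos) auto
        qed
      qed
    qed
    moreover obtain n where "D / r < 2 ^ n" using real_arch_pow[of 2 "D / r"] by auto
    ultimately show "c * measure m (ball x r) \<le> measure m (ball x r \<inter> E)"
      using r unfolding f_def g_def D_def by (simp add: field_simps)
  qed (rule c)
qed

end

theorem proposition4p2:
  fixes m :: "'a::polish_space measure" and E :: "'a set"
  assumes "PI_space m"
    and "bounded E"
    and "BV_extension_set m E"
    and "emeasure m E > 0"
  shows "\<exists>C::real. C > 0 \<and>
    (\<forall>x \<in> closure (UNIV - density_zero_points m E). \<forall>r. 0 < r \<and> r < diameter E \<longrightarrow>
      measure m (ball x r \<inter> E) \<ge> C * measure m (ball x r))"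
proof -
  obtain Cd CP \<Lambda> where "doubling_Poincare_space m Cd CP \<Lambda>"
    using PI_space_doubling_Poincare_space[OF assms(1)] .
  then interpret doubling_Poincare_space m Cd CP \<Lambda> .
  obtain C T where E: "E \<in> sets borel" and C: "C \<ge> 1"
    and T: "\<And>u. u \<in> BV m E \<Longrightarrow> T u \<in> BV m UNIV \<and> (AE x in m. x \<in> E \<longrightarrow> T u x = u x) \<and>
        BV_norm m UNIV (T u) \<le> ennreal C * BV_norm m E u"
    using assms(3) unfolding BV_extension_set_def by blast
  have "measure m E > 0"
    using assms(4) emeasure_bounded[OF E assms(2)] by simp
  then obtain c where c: "c > 0" "\<And>x r. 0 < r \<Longrightarrow> r < diameter E \<Longrightarrow> \<forall>s>0. measure m (ball x s \<inter> E) > 0 \<Longrightarrow>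
      c * measure m (ball x r) \<le> measure m (ball x r \<inter> E)"
    using extension_set_measure_density[OF E assms(2) _ C T] by blast
  have "measure m (ball x s \<inter> E) > 0"
    if "x \<in> closure (UNIV - density_zero_points m E)" "s > 0" for x s
  proof -
    have "bounded (ball x s \<inter> E)" by (rule bounded_subset[OF bounded_ball]) auto
    then have "emeasure m (ball x s \<inter> E) = ennreal (measure m (ball x s \<inter> E))"
      using E by (intro emeasure_bounded) auto
    then show ?thesis using not_density_zero_point_imp_positive[OF E that] by (simp add: zero_less_measure_iff)
  qed
  with c show ?thesis by blast
qed

end
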